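(* Let $G$ be a finite group with $G/Z(G)\cong D_{2m}$, $m\ge3$, and $z=|Z(G)|$. Then: (1) $\Gamma_G$ is borderenergetic if $m=3$ and $z=1$; (2) $\Gamma_G$ is not hyperenergetic; (3) $\Gamma_G$ is L-borderenergetic if $m=3$ and $z=1$; (4) $\Gamma_G$ is L-hyperenergetic unless $z=1$, or $m=3$, or $(m,z)=(5,2)$ (in these cases it is not L-hyperenergetic); (5) $\Gamma_G$ is Q-borderenergetic if $m=3$ and $z=1$; (6) $\Gamma_G$ is Q-hyperenergetic unless $z=1$, or $m=3$, or $(m,z)\in\{(5,2),(4,2)\}$ (in these cases it is not Q-hyperenergetic).
   Context: $D_{2m}=\langle x,y\mid x^m=y^2=1,\ yxy^{-1}=x^{-1}\rangle$. The NCCC-graph $\Gamma_G$ of a finite non-abelian group $G$ with center $Z(G)$ has vertex set $\{x^G: x\in G\setminus Z(G)\}$ ($x^G$ the conjugacy class of $x$), distinct vertices $x^G,y^G$ adjacent iff $x'y'\neq y'x'$ for all $x'\in x^G,y'\in y^G$. For a simple graph $\mathcal G$ with adjacency matrix $A$, degree matrix $D$, $L=D-A$, $Q=D+A$: $E(\mathcal G)=\sum|\lambda|$ over eigenvalues of $A$; with $\Delta=2|E(\mathcal G)|/|V(\mathcal G)|$, $LE(\mathcal G)=\sum|\beta-\Delta|$ over eigenvalues of $L$, $SE(\mathcal G)=\sum|\gamma-\Delta|$ over eigenvalues of $Q$ (with multiplicity). For $N=|V(\mathcal G)|$, $E(K_N)=LE(K_N)=SE(K_N)=2(N-1)$. $\mathcal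 G$ is hyperenergetic if $E(\mathcal G)>E(K_N)$ and borderenergetic if $E(\mathcal G)=E(K_N)$; L-hyperenergetic/L-borderenergetic and Q-hyperenergetic/Q-borderenergetic are defined analogously with $LE$ and $SE$. *)

theory Defs
  imports "HOL-Algebra.Algebra" "Jordan_Normal_Form.Char_Poly"
begin

definition group_center :: "('a, 'b) monoid_scheme \<Rightarrow> 'a set" where
  "group_center G = {x \<in> carrier G. \<forall>y \<in> carrier G. x \<otimes>\<^bsub>G\<^esub> y = y \<otimes>\<^bsub>G\<^esub> x}"

definition conj_class :: "('a, 'b) monoid_scheme \<Rightarrow> 'a \<Rightarrow> 'a set" where
  "conj_class G x = {g \<otimes>\<^bsub>G\<^esub> x \<otimes>\<^bsub>G\<^esub> inv\<^bsub>G\<^esub> g | g. g \<in> carrier G}"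

text \<open>Concrete model of the dihedral group D_{2m} of order 2m: the pair (k, s) stands
  for x^k y^(if s then 1 else 0), with 0 \<le> k < m.  Since y x^b = x^(-b) y we get
  x^a y^s x^b y^t = x^(a + (if s then -b else b)) y^(s + t).\<close>

definition dihedral_group :: "nat \<Rightarrow> (int \<times> bool) monoid" where
  "dihedral_group m =
     \<lparr> carrier = {(k, s). 0 \<le> k \<and> k < int m},
       Group.monoid.mult = (\<lambda>(a, s) (b, t). ((a + (if s then - b else b)) mod int m, s \<noteq> t)),
       Group.monoid.one = (0, False) \<rparr>"

definition nccc_vertices :: "('a, 'b) monoid_scheme \<Rightarrow> 'a set set" where
  "nccc_vertices G = conj_class G ` (carrier G - group_center G)"

definition nccc_adj :: "('a, 'b) monoid_scheme \<Rightarrow> 'a set \<Rightarrow> 'a set \<Rightarrow> bool" where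
  "nccc_adj G A B = (A \<noteq> B \<and> (\<forall>x \<in> A. \<forall>y \<in> B. x \<otimes>\<^bsub>G\<^esub> y \<noteq> y \<otimes>\<^bsub>G\<^esub> x))"

text \<open>An (arbitrary) enumeration of the vertex set; all energies below are
  independent of the choice since similar matrices have the same spectrum.\<close>
definition vert_enum :: "'v set \<Rightarrow> nat \<Rightarrow> 'v" where
  "vert_enum V = (SOME f. bij_betw f {0..<card V} V)"

definition graph_degree :: "'v set \<Rightarrow> ('v \<Rightarrow> 'v \<Rightarrow> bool) \<Rightarrow> 'v \<Rightarrow> nat" where
  "graph_degree V E v = card {u \<in> V. E v u}"

definition num_edges :: "'v set \<Rightarrow> ('v \<Rightarrow> 'v \<Rightarrow> bool) \<Rightarrow> nat" where
  "num_edges V E = card {{u, v} | u v. u \<in> V \<and> v \<in> V \<and> E u v}"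

definition adj_matrix :: "'v set \<Rightarrow> ('v \<Rightarrow> 'v \<Rightarrow> bool) \<Rightarrow> real mat" where
  "adj_matrix V E = mat (card V) (card V)
     (\<lambda>(i, j). if E (vert_enum V i) (vert_enum V j) then 1 else 0)"

definition deg_matrix :: "'v set \<Rightarrow> ('v \<Rightarrow> 'v \<Rightarrow> bool) \<Rightarrow> real mat" where
  "deg_matrix V E = mat (card V) (card V)
     (\<lambda>(i, j). if i = j then real (graph_degree V E (vert_enum V i)) else 0)"

definition laplacian_matrix :: "'v set \<Rightarrow> ('v \<Rightarrow> 'v \<Rightarrow> bool) \<Rightarrow> real mat" where
  "laplacian_matrix V E = deg_matrix V E - adj_matrix V E"

definition signless_laplacian_matrix :: "'v set \<Rightarrow> ('v \<Rightarrow> 'v \<Rightarrow> bool) \<Rightarrow> real mat" where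
  "signless_laplacian_matrix V E = deg_matrix V E + adj_matrix V E"

definition shifted_spectral_sum :: "real mat \<Rightarrow> real \<Rightarrow> real" where
  "shifted_spectral_sum M c =
     (let p = char_poly (map_mat complex_of_real M) in
      \<Sum>a \<in> {a. poly p a = 0}. real (order a p) * cmod (a - complex_of_real c))"

definition avg_degree :: "'v set \<Rightarrow> ('v \<Rightarrow> 'v \<Rightarrow> bool) \<Rightarrow> real" where
  "avg_degree V E = 2 * real (num_edges V E) / real (card V)"

definition energy :: "'v set \<Rightarrow> ('v \<Rightarrow> 'v \<Rightarrow> bool) \<Rightarrow> real" where
  "energy V E = shifted_spectral_sum (adj_matrix V E) 0"

definition laplacian_energy :: "'v set \<Rightarrow> ('v \<Rightarrow> 'v \<Rightarrow> bool) \<Rightarrow> real" where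
  "laplacian_energy V E = shifted_spectral_sum (laplacian_matrix V E) (avg_degree V E)"

definition signless_laplacian_energy :: "'v set \<Rightarrow> ('v \<Rightarrow> 'v \<Rightarrow> bool) \<Rightarrow> real" where
  "signless_laplacian_energy V E =
     shifted_spectral_sum (signless_laplacian_matrix V E) (avg_degree V E)"

text \<open>E(K_N) = LE(K_N) = SE(K_N) = 2(N - 1).\<close>
definition complete_energy :: "'v set \<Rightarrow> real" where
  "complete_energy V = 2 * (real (card V) - 1)"

definition hyperenergetic where "hyperenergetic V E \<longleftrightarrow> energy V E > complete_energy V"
definition borderenergetic where "borderenergetic V E \<longleftrightarrow> energy V E = complete_energy V"
definition L_hyperenergetic where
  "L_hyperenergetic V E \<longleftrightarrow> laplacian_energy V E > complete_energy V"
definition L_borderenergetic where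
  "L_borderenergetic V E \<longleftrightarrow> laplacian_energy V E = complete_energy V"
definition Q_hyperenergetic where
  "Q_hyperenergetic V E \<longleftrightarrow> signless_laplacian_energy V E > complete_energy V"
definition Q_borderenergetic where
  "Q_borderenergetic V E \<longleftrightarrow> signless_laplacian_energy V E = complete_energy V"

end

(* Let A be the preimage of the rotations under G -> G/Z(G). It is abelian, noncentral elements of A
   commute with nothing outside A, and two elements outside A commute iff they have the same image in the
   dihedral group. Hence noncentral classes inside A have size 2, classes outside A have size m, and the
   NCCC-graph is complete bipartite with parts (m-1)z/2, z for odd m, and complete tripartite with parts
   (m-1)z/2, z/2, z/2 for even m. For a complete multipartite graph the partition is equitable, so the
   spectra of A, L and Q are read off the 2x2 or 3x3 quotient matrices, and the claims become polynomial
   inequalities in m and z. *)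
theory Submission
  imports Defs
begin

text \<open>The energies sum over roots of a characteristic polynomial with multiplicity, so the
  quotient spectrum alone is not enough: a whole eigenbasis has to be exhibited. Differences of two
  vertices of one part supply the missing eigenvectors. In the group, A is abelian because
  \<open>Z(G)\<close> and one lift of the generating rotation generate it, and an element of A
  commuting with a single element outside A commutes with everything. Parity of m enters because
  conjugating a reflection by a rotation shifts its exponent by an even amount. The exceptional
  pairs are small cases of strict inequalities: (5,2) is a near miss in the bipartite comparison,
  while (4,2) is lost only for Q, since in the tripartite case SE may fall short of LE by up to
  z.\<close>

section \<open>Spectra of matrices with an equitable partition\<close>

text \<open>Similarity to a diagonal matrix makes the characteristic polynomial the product of the
  factors X - d i. The order of a root a is then the number of indices i with d i = a, and
  regrouping by roots turns the weighted sum over roots into a sum over indices.\<close>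

lemma shifted_spectral_sum_diagonalizable:
  fixes M P :: "real mat"
  assumes M: "M \<in> carrier_mat n n" and P: "P \<in> carrier_mat n n"
    and MP: "M * P = P * mat_diag n d" and det: "det P \<noteq> 0"
  shows "shifted_spectral_sum M c = (\<Sum>i<n. \<bar>d i - c\<bar>)"
proof -
  let ?D = "mat_diag n d"
  obtain R where R: "R \<in> carrier_mat n n" "R * P = 1\<^sub>m n" "P * R = 1\<^sub>m n"
    using det_non_zero_imp_unit[OF P det, of "()"]
    by (auto simp: Units_def ring_mat_def)
  have D: "?D \<in> carrier_mat n n" by simp
  have "M = M * (P * R)" using M R by simp
  also have "\<dots> = M * P * R" by (rule assoc_mult_mat[OF M P R(1), symmetric])
  also have "\<dots> = P * ?D * R" by (simp only: MP)
  finally have "similar_mat_wit M ?D P R"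
    by (rule similar_mat_witI[OF R(3,2) _ M D P R(1)])
  hence "similar_mat M ?D" unfolding similar_mat_def by blast
  hence "char_poly M = char_poly ?D" by (rule char_poly_similar)
  also have "\<dots> = (\<Prod>a\<leftarrow>diag_mat ?D. [:- a, 1:])"
    by (rule char_poly_upper_triangular[OF D]) (auto simp: upper_triangular_def mat_diag_def)
  also have "diag_mat ?D = map d [0..<n]"
    by (auto simp: diag_mat_def mat_diag_def)
  finally have M_poly: "char_poly M = (\<Prod>i<n. [:- d i, 1:])"
    by (simp add: o_def prod.distinct_set_conv_list[symmetric] atLeast0LessThan)
  define p where "p = char_poly (map_mat complex_of_real M)"
  interpret map_poly_of_real: map_poly_comm_ring_hom complex_of_real ..
  have "p = map_poly complex_of_real (char_poly M)"
    unfolding p_def by (rule of_real_hom.char_poly_hom[OF M])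
  also have "\<dots> = (\<Prod>i<n. [:- complex_of_real (d i), 1:])"
    unfolding M_poly map_poly_of_real.hom_prod by (simp add: of_real_hom.map_poly_pCons_hom)
  finally have p: "p = (\<Prod>i<n. [:- complex_of_real (d i), 1:])" .
  have p0: "p \<noteq> 0" unfolding p by simp
  have roots: "proots p = (\<Sum>i<n. {#complex_of_real (d i)#})"
    unfolding p by (subst proots_prod) auto
  have order: "Polynomial.order a p = card {i \<in> {..<n}. complex_of_real (d i) = a}" for a
  proof -
    have "Polynomial.order a p = (\<Sum>i<n. if complex_of_real (d i) = a then 1 else 0)"
      using p0 by (simp flip: count_proots add: roots count_sum if_distrib cong: if_cong)
    thus ?thesis by (simp add: sum.If_cases Int_def)
  qed
  have "shifted_spectral_sum M c = (\<Sum>a\<in>{a. poly p a = 0}. real (Polynomial.order a p) * cmod (a - complex_of_real c))"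
    unfolding shifted_spectral_sum_def p_def Let_def ..
  also have "\<dots> = (\<Sum>a\<in>{a. poly p a = 0}. \<Sum>i\<in>{i \<in> {..<n}. complex_of_real (d i) = a}.
      cmod (complex_of_real (d i) - complex_of_real c))"
    by (intro sum.cong refl) (simp add: order)
  also have "\<dots> = (\<Sum>i<n. cmod (complex_of_real (d i) - complex_of_real c))"
    by (rule sum.group) (use p0 poly_roots_finite in \<open>auto simp: p poly_prod\<close>)
  also have "\<dots> = (\<Sum>i<n. \<bar>d i - c\<bar>)"
    by (simp flip: of_real_diff)
  finally show ?thesis .
qed

text \<open>Removes the arbitrary enumeration, of which only bijectivity matters. The eigenvectors
  are indexed by the vertices themselves (column w of \<open>U\<close> has eigenvalue
  \<open>d w\<close>), so that \<open>U\<close> is square and a trivial kernel amounts to a nonzero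
  determinant.\<close>

lemma shifted_spectral_sum_eigenbasis:
  fixes F U :: "'v \<Rightarrow> 'v \<Rightarrow> real"
  assumes V: "finite V"
    and eig: "\<And>u w. u \<in> V \<Longrightarrow> w \<in> V \<Longrightarrow> (\<Sum>v\<in>V. F u v * U v w) = U u w * d w"
    and indep: "\<forall>a. (\<forall>u\<in>V. (\<Sum>w\<in>V. U u w * a w) = 0) \<longrightarrow> (\<forall>w\<in>V. a w = 0)"
  shows "shifted_spectral_sum (mat (card V) (card V) (\<lambda>(i, j). F (vert_enum V i) (vert_enum V j))) c
           = (\<Sum>v\<in>V. \<bar>d v - c\<bar>)"
proof -
  let ?n = "card V" and ?e = "vert_enum V"
  have e: "bij_betw ?e {0..<?n} V"
    unfolding vert_enum_def by (rule someI_ex[OF ex_bij_betw_nat_finite[OF V]])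
  have eV: "?e i \<in> V" if "i < ?n" for i
    using e that by (auto simp: bij_betw_def)
  have sum_e: "(\<Sum>i\<in>{0..<?n}. g (?e i)) = sum g V" for g :: "'v \<Rightarrow> real"
    by (rule sum.reindex_bij_betw[OF e])
  let ?M = "mat ?n ?n (\<lambda>(i, j). F (?e i) (?e j))"
  let ?P = "mat ?n ?n (\<lambda>(i, j). U (?e i) (?e j))"
  have "?M * ?P = ?P * mat_diag ?n (\<lambda>i. d (?e i))"
    by (subst mat_diag_mult_right[of _ ?n], simp, intro eq_matI)
       (auto simp: scalar_prod_def sum_e[of "\<lambda>v. F _ v * U v _"] eig eV)
  moreover have "det ?P \<noteq> 0"
  proof
    assume "det ?P = 0"
    then obtain x where x: "x \<in> carrier_vec ?n" "x \<noteq> 0\<^sub>v ?n" "?P *\<^sub>v x = 0\<^sub>v ?n"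
      using det_0_iff_vec_prod_zero[of ?P ?n] by auto
    \<comment> \<open>A kernel vector of the enumerated matrix, transported back to the
      vertices.\<close>
    define a where "a v = x $ (inv_into {0..<?n} ?e v)" for v
    have ae: "a (?e i) = x $ i" if "i < ?n" for i
      unfolding a_def using bij_betw_inv_into_left[OF e] that by simp
    have "(\<Sum>w\<in>V. U u w * a w) = 0" if u: "u \<in> V" for u
    proof -
      obtain i where i: "i < ?n" "u = ?e i"
        using e u unfolding bij_betw_def by (metis atLeastLessThan_iff imageE)
      have "(\<Sum>w\<in>V. U u w * a w) = (\<Sum>j\<in>{0..<?n}. U u (?e j) * a (?e j))"
        by (rule sum_e[symmetric])
      also have "\<dots> = (?P *\<^sub>v x) $ i"
        using i x(1) by (auto simp: scalar_prod_def ae intro!: sum.cong)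
      finally show ?thesis using x(3) i by simp
    qed
    hence "a w = 0" if "w \<in> V" for w
      using indep that by blast
    hence "x $ i = 0" if "i < ?n" for i
      using ae[OF that] eV[OF that] by simp
    hence "x = 0\<^sub>v ?n" using x(1) by (intro eq_vecI) auto
    with x(2) show False by simp
  qed
  ultimately have "shifted_spectral_sum ?M c = (\<Sum>i<?n. \<bar>d (?e i) - c\<bar>)"
    by (intro shifted_spectral_sum_diagonalizable[where P = ?P]) auto
  thus ?thesis using sum_e[of "\<lambda>v. \<bar>d v - c\<bar>"] by (simp add: atLeast0LessThan)
qed

text \<open>\<open>F\<close> is a diagonal matrix constant on parts plus a matrix that sees only
  parts. Its quotient matrix has entries \<open>W k l * n l\<close>, with \<open>\<delta> k\<close>
  added on the diagonal; \<open>Y\<close> lists the quotient eigenvectors as columns, again indexed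
  by the parts. Vectors supported on part k with sum zero account for the remaining n k - 1
  eigenvalues \<open>\<delta> k\<close>.\<close>

lemma shifted_spectral_sum_equitable_partition:
  fixes W Y :: "'k \<Rightarrow> 'k \<Rightarrow> real" and \<kappa> :: "'v \<Rightarrow> 'k"
  assumes V: "finite V" and K: "finite K" and \<kappa>: "\<kappa> ` V = K"
    and n: "\<And>k. k \<in> K \<Longrightarrow> n k = real (card {v \<in> V. \<kappa> v = k})"
    and eig: "\<And>k r. k \<in> K \<Longrightarrow> r \<in> K \<Longrightarrow> \<delta> k * Y k r + (\<Sum>l\<in>K. W k l * n l * Y l r) = Y k r * \<mu> r"
    and indep: "\<forall>a. (\<forall>k\<in>K. (\<Sum>r\<in>K. Y k r * a r) = 0) \<longrightarrow> (\<forall>r\<in>K. a r = 0)"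
    and F: "\<And>u v. u \<in> V \<Longrightarrow> v \<in> V \<Longrightarrow> F u v = (if u = v then \<delta> (\<kappa> u) else 0) + W (\<kappa> u) (\<kappa> v)"
  shows "shifted_spectral_sum (mat (card V) (card V) (\<lambda>(i, j). F (vert_enum V i) (vert_enum V j))) c
           = (\<Sum>k\<in>K. (n k - 1) * \<bar>\<delta> k - c\<bar> + \<bar>\<mu> k - c\<bar>)"
proof -
  define \<rho> where "\<rho> k = (SOME v. v \<in> V \<and> \<kappa> v = k)" for k
  have \<rho>: "\<rho> k \<in> V" "\<kappa> (\<rho> k) = k" if "k \<in> K" for k
  proof -
    have "\<exists>v. v \<in> V \<and> \<kappa> v = k" using \<kappa> that by auto
    thus "\<rho> k \<in> V" "\<kappa> (\<rho> k) = k" unfolding \<rho>_def by (metis (mono_tags, lifting) someI_ex)+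
  qed
  have \<kappa>K: "\<kappa> v \<in> K" if "v \<in> V" for v using \<kappa> that by auto
  \<comment> \<open>With \<open>\<rho> k\<close> a representative of part \<open>k\<close>, the eigenvectors are \<open>1\<^sub>w - 1\<^sub>\<rho>\<close> for the
    non-representatives \<open>w\<close>, and at the representatives the lifts of the eigenvectors of the quotient matrix.\<close>
  define U where "U v w = (if w = \<rho> (\<kappa> w) then Y (\<kappa> v) (\<kappa> w)
      else (if v = w then 1 else 0) - (if v = \<rho> (\<kappa> w) then 1 else 0))" for v w
  define d where "d w = (if w = \<rho> (\<kappa> w) then \<mu> (\<kappa> w) else \<delta> (\<kappa> w))" for w
  have fibres: "sum g V = (\<Sum>k\<in>K. sum g {v \<in> V. \<kappa> v = k})" for g :: "'v \<Rightarrow> real"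
    using sum.group[OF V K, of \<kappa> g] \<kappa> by simp
  have fibre_const: "(\<Sum>v\<in>V. g (\<kappa> v)) = (\<Sum>k\<in>K. n k * g k)" for g :: "'k \<Rightarrow> real"
    unfolding fibres by (intro sum.cong refl) (simp add: n)
  have "shifted_spectral_sum (mat (card V) (card V) (\<lambda>(i, j). F (vert_enum V i) (vert_enum V j))) c
      = (\<Sum>v\<in>V. \<bar>d v - c\<bar>)"
  proof (rule shifted_spectral_sum_eigenbasis[where U = U, OF V])
    fix u w assume u: "u \<in> V" and w: "w \<in> V"
    have split: "(\<Sum>v\<in>V. F u v * g v) = \<delta> (\<kappa> u) * g u + (\<Sum>v\<in>V. W (\<kappa> u) (\<kappa> v) * g v)" for g
    proof -
      have "(\<Sum>v\<in>V. F u v * g v)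
          = (\<Sum>v\<in>V. (if v = u then \<delta> (\<kappa> u) * g u else 0) + W (\<kappa> u) (\<kappa> v) * g v)"
        by (intro sum.cong refl) (auto simp: F u algebra_simps)
      thus ?thesis using V u by (simp add: sum.distrib)
    qed
    show "(\<Sum>v\<in>V. F u v * U v w) = U u w * d w"
    proof (cases "w = \<rho> (\<kappa> w)")
      case True
      have "(\<Sum>v\<in>V. W (\<kappa> u) (\<kappa> v) * U v w) = (\<Sum>v\<in>V. W (\<kappa> u) (\<kappa> v) * Y (\<kappa> v) (\<kappa> w))"
        using True by (simp add: U_def)
      also have "\<dots> = (\<Sum>k\<in>K. W (\<kappa> u) k * n k * Y k (\<kappa> w))"
        by (subst fibre_const) (simp add: mult_ac)
      finally show ?thesis
        unfolding split using eig[OF \<kappa>K[OF u] \<kappa>K[OF w]] True by (simp add: U_def d_def)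
    next
      case False
      \<comment> \<open>Both vertices of the difference vector lie in the same part, so
        \<open>W\<close> gives them equal weight and the contributions cancel.\<close>
      have "(\<Sum>v\<in>V. W (\<kappa> u) (\<kappa> v) * U v w)
          = (\<Sum>v\<in>V. (if v = w then W (\<kappa> u) (\<kappa> w) else 0) - (if v = \<rho> (\<kappa> w) then W (\<kappa> u) (\<kappa> (\<rho> (\<kappa> w))) else 0))"
        using False by (intro sum.cong refl) (auto simp: U_def)
      also have "\<dots> = 0"
        using V w \<rho>[OF \<kappa>K[OF w]] by (simp add: sum_subtractf)
      finally show ?thesis
        unfolding split using False \<rho>[OF \<kappa>K[OF w]] by (auto simp: U_def d_def)
    qed
  next
    show "\<forall>a. (\<forall>u\<in>V. (\<Sum>w\<in>V. U u w * a w) = 0) \<longrightarrow> (\<forall>w\<in>V. a w = 0)"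
    proof (intro allI impI ballI)
      fix a w assume a: "\<forall>u\<in>V. (\<Sum>w\<in>V. U u w * a w) = 0" and w: "w \<in> V"
      \<comment> \<open>Summing a linear relation over a part kills the difference vectors. What
        remains is a relation between quotient eigenvectors, so \<open>indep\<close> makes the
        coefficients at the representatives vanish.\<close>
      define N where "N = {w \<in> V. w \<noteq> \<rho> (\<kappa> w)}"
      have VN: "V = N \<union> \<rho> ` K" "N \<inter> \<rho> ` K = {}"
        unfolding N_def using \<rho> \<kappa>K by auto
      have finN: "finite N" using V VN by auto
      have inj: "inj_on \<rho> K" by (metis \<rho>(2) inj_onI)
      have row: "(\<Sum>w\<in>N. U u w * a w) + (\<Sum>r\<in>K. Y (\<kappa> u) r * a (\<rho> r)) = 0" if "u \<in> V" for u
      proof -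
        have "(\<Sum>w\<in>V. U u w * a w) = (\<Sum>w\<in>N. U u w * a w) + (\<Sum>w\<in>\<rho> ` K. U u w * a w)"
          by (subst VN(1), rule sum.union_disjoint) (use finN K VN in auto)
        also have "(\<Sum>w\<in>\<rho> ` K. U u w * a w) = (\<Sum>r\<in>K. Y (\<kappa> u) r * a (\<rho> r))"
          by (subst sum.reindex[OF inj]) (auto simp: U_def \<rho> intro!: sum.cong)
        finally show ?thesis using a that by simp
      qed
      have col: "(\<Sum>u\<in>{v \<in> V. \<kappa> v = k}. U u w) = 0" if "w \<in> N" "k \<in> K" for w k
      proof -
        have w: "w \<in> V" "w \<noteq> \<rho> (\<kappa> w)" using that by (auto simp: N_def)
        have "(\<Sum>u\<in>{v \<in> V. \<kappa> v = k}. U u w)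
          = (\<Sum>u\<in>{v \<in> V. \<kappa> v = k}. (if u = w then 1 else 0) - (if u = \<rho> (\<kappa> w) then 1 else 0))"
          using w by (intro sum.cong refl) (auto simp: U_def)
        also have "\<dots> = 0"
          using V w \<rho>[OF \<kappa>K[OF w(1)]] by (auto simp: sum_subtractf)
        finally show ?thesis .
      qed
      have "(\<Sum>r\<in>K. Y k r * a (\<rho> r)) = 0" if k: "k \<in> K" for k
      proof -
        have "0 = (\<Sum>u\<in>{v \<in> V. \<kappa> v = k}. (\<Sum>w\<in>N. U u w * a w) + (\<Sum>r\<in>K. Y (\<kappa> u) r * a (\<rho> r)))"
          by (rule sum.neutral[symmetric]) (use row in blast)
        also have "\<dots> = (\<Sum>u\<in>{v \<in> V. \<kappa> v = k}. \<Sum>w\<in>N. U u w * a w)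
            + (\<Sum>u\<in>{v \<in> V. \<kappa> v = k}. \<Sum>r\<in>K. Y (\<kappa> u) r * a (\<rho> r))"
          by (rule sum.distrib)
        also have "(\<Sum>u\<in>{v \<in> V. \<kappa> v = k}. \<Sum>w\<in>N. U u w * a w)
            = (\<Sum>w\<in>N. (\<Sum>u\<in>{v \<in> V. \<kappa> v = k}. U u w) * a w)"
          by (subst sum.swap) (simp add: sum_distrib_right)
        also have "\<dots> = 0" using col k by simp
        also have "(\<Sum>u\<in>{v \<in> V. \<kappa> v = k}. \<Sum>r\<in>K. Y (\<kappa> u) r * a (\<rho> r))
            = n k * (\<Sum>r\<in>K. Y k r * a (\<rho> r))"
          by (simp add: n k)
        finally have "n k * (\<Sum>r\<in>K. Y k r * a (\<rho> r)) = 0" by simp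
        moreover have "{v \<in> V. \<kappa> v = k} \<noteq> {}" using \<rho>[OF k] by auto
        hence "n k \<noteq> 0" using V n[OF k] by (simp add: card_gt_0_iff)
        ultimately show ?thesis by simp
      qed
      hence aK: "a (\<rho> r) = 0" if "r \<in> K" for r
        using indep[rule_format, of "\<lambda>r. a (\<rho> r)"] that by blast
      show "a w = 0"
      proof (cases "w \<in> N")
        case False
        with w VN aK show ?thesis by auto
      next
        case True
        \<comment> \<open>A non-representative w occurs in exactly one difference vector, its own,
          so row w isolates the coefficient at w.\<close>
        have "0 = (\<Sum>x\<in>N. U w x * a x)" using row[OF w] aK by simp
        also have "\<dots> = (\<Sum>x\<in>N. if x = w then a w else 0)"
          using True w \<rho> \<kappa>K by (intro sum.cong refl) (auto simp: N_def U_def)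
        also have "\<dots> = a w" using finN True by simp
        finally show ?thesis by simp
      qed
    qed
  qed
  also have "\<dots> = (\<Sum>k\<in>K. \<Sum>v\<in>{v \<in> V. \<kappa> v = k}. \<bar>d v - c\<bar>)" by (rule fibres)
  also have "\<dots> = (\<Sum>k\<in>K. (n k - 1) * \<bar>\<delta> k - c\<bar> + \<bar>\<mu> k - c\<bar>)"
  proof (intro sum.cong refl)
    fix k assume k: "k \<in> K"
    let ?S = "{v \<in> V. \<kappa> v = k}"
    have S: "finite ?S" "\<rho> k \<in> ?S" using V \<rho>[OF k] by auto
    have "(\<Sum>v\<in>?S. \<bar>d v - c\<bar>) = \<bar>d (\<rho> k) - c\<bar> + (\<Sum>v\<in>?S - {\<rho> k}. \<bar>d v - c\<bar>)"
      by (rule sum.remove[OF S])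
    also have "(\<Sum>v\<in>?S - {\<rho> k}. \<bar>d v - c\<bar>) = (\<Sum>v\<in>?S - {\<rho> k}. \<bar>\<delta> k - c\<bar>)"
      by (intro sum.cong) (auto simp: d_def)
    also have "\<dots> = (real (card ?S) - 1) * \<bar>\<delta> k - c\<bar>"
    proof -
      have "real (card (?S - {\<rho> k})) = real (card ?S) - 1"
        using card_Suc_Diff1[OF S] by linarith
      thus ?thesis by simp
    qed
    finally show "(\<Sum>v\<in>?S. \<bar>d v - c\<bar>) = (n k - 1) * \<bar>\<delta> k - c\<bar> + \<bar>\<mu> k - c\<bar>"
      using \<rho>[OF k] by (simp add: d_def n k)
  qed
  finally show ?thesis .
qed

section \<open>Complete multipartite graphs\<close>

text \<open>Double counting: the map from ordered adjacent pairs to their underlying sets has fibres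
  of size two, because the graph has no loops.\<close>

lemma two_num_edges_eq_sum_degree:
  assumes V: "finite V" and sym: "\<And>u v. u \<in> V \<Longrightarrow> v \<in> V \<Longrightarrow> E u v \<Longrightarrow> E v u"
    and irrefl: "\<And>v. v \<in> V \<Longrightarrow> \<not> E v v"
  shows "2 * num_edges V E = (\<Sum>v\<in>V. graph_degree V E v)"
proof -
  define D where "D = (SIGMA u:V. {v \<in> V. E u v})"
  have D: "finite D" unfolding D_def using V by simp
  let ?\<phi> = "\<lambda>(u, v). {u, v}"
  have edges: "{{u, v} | u v. u \<in> V \<and> v \<in> V \<and> E u v} = ?\<phi> ` D"
    by (auto simp: D_def)
  have fibre: "card {x \<in> D. ?\<phi> x = e} = 2" if e: "e \<in> ?\<phi> ` D" for e
  proof -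
    obtain u v where uv: "e = {u, v}" "u \<in> V" "v \<in> V" "E u v"
      using e by (auto simp: D_def)
    hence "u \<noteq> v" using irrefl by auto
    moreover have "{x \<in> D. ?\<phi> x = e} = {(u, v), (v, u)}"
    proof (intro equalityI subsetI)
      fix x assume "x \<in> {x \<in> D. ?\<phi> x = e}"
      then show "x \<in> {(u, v), (v, u)}"
        by (cases x) (auto simp: uv(1) doubleton_eq_iff)
    next
      have "(u, v) \<in> D" "(v, u) \<in> D"
        using uv(2-4) sym[OF uv(2-4)] unfolding D_def by blast+
      moreover fix x assume "x \<in> {(u, v), (v, u)}"
      ultimately show "x \<in> {x \<in> D. ?\<phi> x = e}"
        by (auto simp: uv(1))
    qed
    ultimately show ?thesis by simp
  qed
  have "(\<Sum>v\<in>V. graph_degree V E v) = card D"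
    unfolding D_def graph_degree_def using V by (intro card_SigmaI[symmetric]) auto
  also have "\<dots> = (\<Sum>e\<in>?\<phi> ` D. card {x \<in> D. ?\<phi> x = e})"
    by (subst card_eq_sum, subst sum.image_gen[OF D, of _ ?\<phi>]) simp
  also have "\<dots> = 2 * num_edges V E"
    unfolding num_edges_def edges by (simp add: fibre cong: sum.cong_simp)
  finally show ?thesis ..
qed

text \<open>The part sizes form a real-valued parameter \<open>n\<close> so that closed formulas can
  be substituted for them; \<open>parts\<close> makes every part nonempty.\<close>

locale complete_multipartite =
  fixes V :: "'v set" and E :: "'v \<Rightarrow> 'v \<Rightarrow> bool" and \<kappa> :: "'v \<Rightarrow> 'k"
    and K :: "'k set" and n :: "'k \<Rightarrow> real"
  assumes finite_V: "finite V" and finite_K: "finite K" and parts: "\<kappa> ` V = K"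
    and n: "\<And>k. k \<in> K \<Longrightarrow> n k = real (card {v \<in> V. \<kappa> v = k})"
    and E: "\<And>u v. u \<in> V \<Longrightarrow> v \<in> V \<Longrightarrow> E u v \<longleftrightarrow> \<kappa> u \<noteq> \<kappa> v"
begin

lemma card_V: "real (card V) = (\<Sum>k\<in>K. n k)"
proof -
  have "real (card V) = (\<Sum>v\<in>V. 1)" by simp
  also have "\<dots> = (\<Sum>k\<in>K. \<Sum>v\<in>{v \<in> V. \<kappa> v = k}. 1)"
    by (rule sum.group[symmetric]) (use finite_V finite_K parts in auto)
  finally show ?thesis by (simp add: n)
qed

lemma degree:
  assumes "v \<in> V"
  shows "real (graph_degree V E v) = (\<Sum>k\<in>K. n k) - n (\<kappa> v)"
proof -
  let ?S = "{u \<in> V. \<kappa> u = \<kappa> v}"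
  have "{u \<in> V. E v u} = V - ?S" using E assms by auto
  hence "real (graph_degree V E v) = real (card V) - real (card ?S)"
    unfolding graph_degree_def using finite_V
    by (simp add: card_Diff_subset card_mono of_nat_diff)
  thus ?thesis using assms parts by (auto simp: card_V n)
qed

lemma avg_degree:
  "avg_degree V E = (\<Sum>k\<in>K. n k * ((\<Sum>l\<in>K. n l) - n k)) / (\<Sum>k\<in>K. n k)"
proof -
  have "2 * real (num_edges V E) = real (\<Sum>v\<in>V. graph_degree V E v)"
    by (subst two_num_edges_eq_sum_degree[OF finite_V, symmetric]) (auto simp: E)
  also have "\<dots> = (\<Sum>v\<in>V. (\<Sum>l\<in>K. n l) - n (\<kappa> v))"
    by (simp add: degree)
  also have "\<dots> = (\<Sum>k\<in>K. \<Sum>v\<in>{v \<in> V. \<kappa> v = k}. (\<Sum>l\<in>K. n l) - n (\<kappa> v))"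
    by (rule sum.group[symmetric]) (use finite_V finite_K parts in auto)
  also have "\<dots> = (\<Sum>k\<in>K. n k * ((\<Sum>l\<in>K. n l) - n k))"
    by (intro sum.cong refl) (simp add: n)
  finally show ?thesis unfolding avg_degree_def card_V by simp
qed

text \<open>Treats the combinations \<alpha> D + \<beta> A at once: (0, 1), (1, -1) and (1, 1) give
  the adjacency, Laplacian and signless Laplacian matrices. Inside a part A vanishes and the degree
  is constant, hence the eigenvalue \<alpha> times that degree.\<close>

lemma spectral_sum:
  assumes eig: "\<And>k r. k \<in> K \<Longrightarrow> r \<in> K \<Longrightarrow>
      \<alpha> * ((\<Sum>l\<in>K. n l) - n k) * Y k r + \<beta> * (\<Sum>l\<in>K. if k = l then 0 else n l * Y l r) = Y k r * \<mu> r"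
    and indep: "\<forall>a. (\<forall>k\<in>K. (\<Sum>r\<in>K. Y k r * a r) = 0) \<longrightarrow> (\<forall>r\<in>K. a r = 0)"
    and M: "M = mat (card V) (card V) (\<lambda>(i, j). \<alpha> * deg_matrix V E $$ (i, j) + \<beta> * adj_matrix V E $$ (i, j))"
  shows "shifted_spectral_sum M c
           = (\<Sum>k\<in>K. (n k - 1) * \<bar>\<alpha> * ((\<Sum>l\<in>K. n l) - n k) - c\<bar> + \<bar>\<mu> k - c\<bar>)"
proof -
  let ?e = "vert_enum V"
  define F where "F u v = (if u = v then \<alpha> * ((\<Sum>l\<in>K. n l) - n (\<kappa> u)) else 0)
      + (if \<kappa> u = \<kappa> v then 0 else \<beta>)" for u v
  have e: "bij_betw ?e {0..<card V} V"
    unfolding vert_enum_def by (rule someI_ex[OF ex_bij_betw_nat_finite[OF finite_V]])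
  have eV: "?e i \<in> V" if "i < card V" for i
    using e that by (auto simp: bij_betw_def)
  have ee: "?e i = ?e j \<longleftrightarrow> i = j" if "i < card V" "j < card V" for i j
    using e that by (auto simp: bij_betw_def dest: inj_onD)
  have "M = mat (card V) (card V) (\<lambda>(i, j). F (?e i) (?e j))"
    unfolding M by (intro eq_matI) (auto simp: F_def deg_matrix_def adj_matrix_def ee eV degree E)
  moreover have "shifted_spectral_sum (mat (card V) (card V) (\<lambda>(i, j). F (?e i) (?e j))) c
           = (\<Sum>k\<in>K. (n k - 1) * \<bar>\<alpha> * ((\<Sum>l\<in>K. n l) - n k) - c\<bar> + \<bar>\<mu> k - c\<bar>)"
  proof (rule shifted_spectral_sum_equitable_partition[OF finite_V finite_K parts n _ indep])
    fix k r assume kr: "k \<in> K" "r \<in> K"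
    have "(\<Sum>l\<in>K. (if k = l then 0 else \<beta>) * n l * Y l r)
        = \<beta> * (\<Sum>l\<in>K. if k = l then 0 else n l * Y l r)"
      unfolding sum_distrib_left by (intro sum.cong) auto
    thus "\<alpha> * ((\<Sum>l\<in>K. n l) - n k) * Y k r + (\<Sum>l\<in>K. (if k = l then 0 else \<beta>) * n l * Y l r)
        = Y k r * \<mu> r"
      using eig[OF kr] by simp
  qed (auto simp: F_def)
  ultimately show ?thesis by simp
qed

text \<open>With \<alpha> = 0 the eigenvalues of the difference vectors are zero, so only the
  quotient spectrum is left.\<close>

lemma energy_eq:
  assumes "\<And>k r. k \<in> K \<Longrightarrow> r \<in> K \<Longrightarrow> (\<Sum>l\<in>K. if k = l then 0 else n l * Y l r) = Y k r * \<mu> r"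
    and "\<forall>a. (\<forall>k\<in>K. (\<Sum>r\<in>K. Y k r * a r) = 0) \<longrightarrow> (\<forall>r\<in>K. a r = 0)"
  shows "energy V E = (\<Sum>k\<in>K. \<bar>\<mu> k\<bar>)"
  unfolding energy_def
  by (subst spectral_sum[where \<alpha> = 0 and \<beta> = 1 and \<mu> = \<mu> and Y = Y, OF _ assms(2)])
     (auto simp: assms(1) adj_matrix_def intro!: eq_matI)

lemma laplacian_energy_eq:
  assumes "\<And>k r. k \<in> K \<Longrightarrow> r \<in> K \<Longrightarrow>
      ((\<Sum>l\<in>K. n l) - n k) * Y k r - (\<Sum>l\<in>K. if k = l then 0 else n l * Y l r) = Y k r * \<mu> r"
    and "\<forall>a. (\<forall>k\<in>K. (\<Sum>r\<in>K. Y k r * a r) = 0) \<longrightarrow> (\<forall>r\<in>K. a r = 0)"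
  shows "laplacian_energy V E
           = (\<Sum>k\<in>K. (n k - 1) * \<bar>(\<Sum>l\<in>K. n l) - n k - avg_degree V E\<bar> + \<bar>\<mu> k - avg_degree V E\<bar>)"
  unfolding laplacian_energy_def
  by (subst spectral_sum[where \<alpha> = 1 and \<beta> = "-1" and \<mu> = \<mu> and Y = Y, OF _ assms(2)])
     (auto simp: assms(1) laplacian_matrix_def adj_matrix_def deg_matrix_def intro!: eq_matI)

lemma signless_laplacian_energy_eq:
  assumes "\<And>k r. k \<in> K \<Longrightarrow> r \<in> K \<Longrightarrow>
      ((\<Sum>l\<in>K. n l) - n k) * Y k r + (\<Sum>l\<in>K. if k = l then 0 else n l * Y l r) = Y k r * \<mu> r"
    and "\<forall>a. (\<forall>k\<in>K. (\<Sum>r\<in>K. Y k r * a r) = 0) \<longrightarrow> (\<forall>r\<in>K. a r = 0)"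
  shows "signless_laplacian_energy V E
           = (\<Sum>k\<in>K. (n k - 1) * \<bar>(\<Sum>l\<in>K. n l) - n k - avg_degree V E\<bar> + \<bar>\<mu> k - avg_degree V E\<bar>)"
  unfolding signless_laplacian_energy_def
  by (subst spectral_sum[where \<alpha> = 1 and \<beta> = 1 and \<mu> = \<mu> and Y = Y, OF _ assms(2)])
     (auto simp: assms(1) signless_laplacian_matrix_def adj_matrix_def deg_matrix_def intro!: eq_matI)

end

section \<open>Energies of complete bipartite and tripartite graphs\<close>

text \<open>L and Q have the same spectrum here: 0, p + q, q with multiplicity p - 1, and p with
  multiplicity q - 1. The average degree lies between q and p, which settles the signs in the
  absolute values.\<close>

lemma complete_bipartite_energies:
  fixes p q :: real
  assumes cm: "complete_multipartite V E \<kappa> {0, 1 :: nat} (\<lambda>k. if k = 0 then p else q)"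
    and p: "p \<ge> q" and q: "q > 0"
  shows "card V = p + q"
    and "energy V E = 2 * sqrt (p * q)"
    and "laplacian_energy V E = 2 * q + (p - q) * (2 * p * q / (p + q))"
    and "signless_laplacian_energy V E = 2 * q + (p - q) * (2 * p * q / (p + q))"
proof -
  interpret complete_multipartite V E \<kappa> "{0, 1}" "\<lambda>k. if k = 0 then p else q" by (rule cm)
  show "card V = p + q" using card_V by simp
  \<comment> \<open>Since p = s^2 and q = t^2, the adjacency quotient has eigenvectors (t, s) and
    (t, -s) with eigenvalues st and -st.\<close>
  define s where "s = sqrt p"
  define t where "t = sqrt q"
  have pos: "s > 0" "t > 0" "p > 0" and sq: "p = s * s" "q = t * t"
    using p q by (auto simp: s_def t_def)
  have "energy V E = (\<Sum>k\<in>{0, 1 :: nat}. \<bar>(if k = 0 then s * t else - s * t)\<bar>)"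
    by (rule energy_eq[where Y = "\<lambda>k r. if k = 0 then t else if r = 0 then s else - s"])
       (use pos in \<open>auto simp: sq algebra_simps\<close>)
  thus "energy V E = 2 * sqrt (p * q)"
    using pos by (simp add: s_def t_def real_sqrt_mult abs_mult)
  define \<Delta> where "\<Delta> = 2 * p * q / (p + q)"
  have avg: "avg_degree V E = \<Delta>"
    unfolding avg_degree \<Delta>_def by (simp add: algebra_simps)
  have "q \<le> \<Delta>" "\<Delta> \<le> p"
    using p q pos unfolding \<Delta>_def by (simp_all add: divide_simps algebra_simps)
  note bds = this
  have *: "(p - 1) * \<bar>q - \<Delta>\<bar> + \<bar>0 - \<Delta>\<bar> + ((q - 1) * \<bar>p - \<Delta>\<bar> + \<bar>p + q - \<Delta>\<bar>)
      = 2 * q + (p - q) * \<Delta>"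
    using bds q pos by (simp add: algebra_simps)
  have cancel: "x = 0" if "p * x + q * x = 0" for x
    using that pos q by (simp flip: distrib_right)
  have cancel': "x = 0 \<and> y = 0" if "x + q * y = 0" "p * y = x" for x y
    using that cancel[of y] by simp
  \<comment> \<open>Eigenvectors (1, 1) for 0 and (q, -p) for p + q.\<close>
  have "laplacian_energy V E = (\<Sum>k\<in>{0, 1 :: nat}.
      ((if k = 0 then p else q) - 1) * \<bar>(\<Sum>l\<in>{0, 1 :: nat}. if l = 0 then p else q) - (if k = 0 then p else q) - avg_degree V E\<bar>
      + \<bar>(if k = 0 then 0 else p + q) - avg_degree V E\<bar>)"
    by (rule laplacian_energy_eq[where Y = "\<lambda>k r. if r = 0 then 1 else if k = 0 then q else - p"])
       (use pos q in \<open>auto simp: algebra_simps dest: cancel\<close>)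
  with * show "laplacian_energy V E = 2 * q + (p - q) * (2 * p * q / (p + q))"
    by (simp add: avg flip: \<Delta>_def)
  \<comment> \<open>Changing the sign on one side of the bipartition turns the Laplacian
    eigenvectors into signless ones.\<close>
  have "signless_laplacian_energy V E = (\<Sum>k\<in>{0, 1 :: nat}.
      ((if k = 0 then p else q) - 1) * \<bar>(\<Sum>l\<in>{0, 1 :: nat}. if l = 0 then p else q) - (if k = 0 then p else q) - avg_degree V E\<bar>
      + \<bar>(if k = 0 then 0 else p + q) - avg_degree V E\<bar>)"
    by (rule signless_laplacian_energy_eq[where Y = "\<lambda>k r. if r = 0 then if k = 0 then 1 else - 1 else if k = 0 then q else p"])
       (use pos q in \<open>auto simp: algebra_simps dest: cancel'\<close>)
  with * show "signless_laplacian_energy V E = 2 * q + (p - q) * (2 * p * q / (p + q))"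
    by (simp add: avg flip: \<Delta>_def)
qed

text \<open>One eigenvector shape serves two matrices: (0, 1, -1) is antisymmetric under swapping
  the parts of size h, and (4h, c + s, c + s), (4h, c - s, c - s) are symmetric. The adjacency
  matrix takes c = h, the signless Laplacian c = p.\<close>

lemma tripartite_basis_independent:
  fixes a :: "nat \<Rightarrow> real"
  assumes s: "s \<noteq> 0" and h: "h \<noteq> 0"
    and 0: "\<forall>k\<in>{0, 1, 2 :: nat}. (\<Sum>r\<in>{0, 1, 2 :: nat}. (if r = 0 then if k = 0 then 0 else if k = 1 then 1 else - 1
      else if k = 0 then 4 * h else if r = 1 then c + s else c - s) * a r) = 0"
  shows "\<forall>r\<in>{0, 1, 2 :: nat}. a r = 0"
proof -
  have "4 * h * a 1 + 4 * h * a 2 = 0" using 0 by (auto simp del: One_nat_def)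
  hence a2: "a 2 = - a 1" using h by (simp flip: distrib_left)
  have "a 0 + ((c + s) * a 1 + (c - s) * a 2) = 0" "- a 0 + ((c + s) * a 1 + (c - s) * a 2) = 0"
    using 0 by (auto simp del: One_nat_def)
  hence "s * a 1 = 0" "a 0 = 0" by (auto simp: a2 algebra_simps)
  thus ?thesis using s a2 by auto
qed

text \<open>The swap of the two equal parts splits off the eigenvector (0, 1, -1), with eigenvalue
  -h for A, p + 2h for L and p for Q; a 2x2 problem on vectors (x, y, y) remains. The bound p \<ge>
  3h gives 2h \<le> \<Delta> \<le> p, which fixes the signs in the absolute values.\<close>

lemma complete_tripartite_energies:
  fixes p h :: real
  assumes cm: "complete_multipartite V E \<kappa> {0, 1, 2 :: nat} (\<lambda>k. if k = 0 then p else h)"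
    and p: "p \<ge> 3 * h" and h: "h > 0"
  defines "\<Delta> \<equiv> 2 * h * (2 * p + h) / (p + 2 * h)"
  shows "card V = p + 2 * h"
    and "energy V E = h + sqrt (h\<^sup>2 + 8 * h * p)"
    and "laplacian_energy V E = (p - 1) * (\<Delta> - 2 * h) + 2 * (h - 1) * (p + h - \<Delta>) + \<Delta> + 2 * (p + 2 * h - \<Delta>)"
    and "signless_laplacian_energy V E = (p - 1) * (\<Delta> - 2 * h) + 2 * (h - 1) * (p + h - \<Delta>)
           + (p - \<Delta>) + sqrt ((p + 4 * h)\<^sup>2 - 16 * h\<^sup>2)"
proof -
  interpret complete_multipartite V E \<kappa> "{0, 1, 2}" "\<lambda>k. if k = 0 then p else h" by (rule cm)
  show "card V = p + 2 * h" using card_V by simp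
  have pos: "p > 0" using p h by simp
  have avg: "avg_degree V E = \<Delta>"
    unfolding avg_degree \<Delta>_def by (simp add: algebra_simps)
  \<comment> \<open>Cleared of its denominator, \<Delta> \<le> p says 2h^2 + 2hp \<le> p^2.\<close>
  have "h * (3 * h) \<le> h * p" "3 * h * p \<le> p * p"
    using p h pos by (intro mult_left_mono mult_right_mono; simp)+
  hence "h * (h * 2) + h * (p * 2) \<le> p * p" using zero_le_square[of h] by (simp only: mult_ac)
  hence bds: "2 * h \<le> \<Delta>" "\<Delta> \<le> p"
    using p h pos unfolding \<Delta>_def
    by (simp_all add: divide_simps algebra_simps)
  { define s where "s = sqrt (h\<^sup>2 + 8 * h * p)"
    have s2: "s * s = h * h + 8 * h * p" unfolding s_def using h pos by (simp add: power2_eq_square)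
    have "sqrt (h\<^sup>2) \<le> s" unfolding s_def using h pos by (intro real_sqrt_le_mono) auto
    hence s: "s > 0" "s \<ge> h" using h by auto
    note indep = tripartite_basis_independent[of s h h, OF less_imp_neq[OF s(1), symmetric] less_imp_neq[OF h, symmetric]]
    \<comment> \<open>On (x, y, y) the equations are 2hy = \<mu>x and px + hy = \<mu>y, so \<mu>^2 -
      h\<mu> - 2hp = 0. Normalising x = 4h gives y = 2\<mu> = h + s or h - s.\<close>
    have "energy V E = (\<Sum>k\<in>{0, 1, 2 :: nat}. \<bar>if k = 0 then - h else if k = 1 then (h + s) / 2 else (h - s) / 2\<bar>)"
      proof (rule energy_eq[where Y = "\<lambda>k r. if r = 0 then if k = 0 then 0 else if k = 1 then 1 else -1
            else if k = 0 then 4 * h else if r = 1 then h + s else h - s"], goal_cases)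
      case 2 show ?case using indep by blast
    qed (use h s s2 in \<open>auto simp: field_simps\<close>)
    thus "energy V E = h + sqrt (h\<^sup>2 + 8 * h * p)"
      unfolding s_def[symmetric] using h s by (simp add: field_simps) }
  have cancel: "x = 0" if "p * x + h * (2 * x) = 0" for x
  proof -
    have "(p + 2 * h) * x = 0" using that by (simp add: algebra_simps)
    thus ?thesis using pos h by simp
  qed
  \<comment> \<open>Eigenvectors (1, 1, 1) for 0, and (0, 1, -1) and (2h, -p, -p), both for p +
    2h.\<close>
  have "laplacian_energy V E = (\<Sum>k\<in>{0, 1, 2 :: nat}.
      ((if k = 0 then p else h) - 1) * \<bar>(\<Sum>l\<in>{0, 1, 2 :: nat}. if l = 0 then p else h) - (if k = 0 then p else h) - avg_degree V E\<bar>
      + \<bar>(if k = 0 then 0 else p + 2 * h) - avg_degree V E\<bar>)"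
    by (rule laplacian_energy_eq[where Y = "\<lambda>k r. if r = 0 then 1 else if r = 1 then
            if k = 0 then 0 else if k = 1 then 1 else - 1 else if k = 0 then 2 * h else - p"])
       (use pos h in \<open>auto simp: algebra_simps dest: cancel\<close>)
  thus "laplacian_energy V E = (p - 1) * (\<Delta> - 2 * h) + 2 * (h - 1) * (p + h - \<Delta>) + \<Delta> + 2 * (p + 2 * h - \<Delta>)"
    using bds h pos by (simp add: avg abs_of_nonneg abs_of_nonpos algebra_simps)
  { define s where "s = sqrt ((p + 4 * h)\<^sup>2 - 16 * h\<^sup>2)"
    have eq: "(p + 4 * h)\<^sup>2 - 16 * h\<^sup>2 = p * p + 8 * p * h"
      by (simp add: power2_eq_square algebra_simps)
    have s2: "s * s = p * p + 8 * h * p" unfolding s_def eq using h pos by simp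
    have "sqrt (p * p) \<le> s" unfolding s_def eq using h pos by (intro real_sqrt_le_mono) auto
    hence s: "s > 0" "s \<ge> p" using pos by auto
    note indep = tripartite_basis_independent[of s h p, OF less_imp_neq[OF s(1), symmetric] less_imp_neq[OF h, symmetric]]
    \<comment> \<open>The symmetric block has trace p + 4h and determinant 4h^2, hence the
      discriminant under the root; x = 4h now gives y = 2\<mu> - 4h.\<close>
    have "signless_laplacian_energy V E = (\<Sum>k\<in>{0, 1, 2 :: nat}.
        ((if k = 0 then p else h) - 1) * \<bar>(\<Sum>l\<in>{0, 1, 2 :: nat}. if l = 0 then p else h) - (if k = 0 then p else h) - avg_degree V E\<bar>
        + \<bar>(if k = 0 then p else if k = 1 then (p + 4 * h + s) / 2 else (p + 4 * h - s) / 2) - avg_degree V E\<bar>)"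
      proof (rule signless_laplacian_energy_eq[where Y = "\<lambda>k r. if r = 0 then if k = 0 then 0 else if k = 1 then 1 else -1
            else if k = 0 then 4 * h else if r = 1 then p + s else p - s"], goal_cases)
      case 2 show ?case using indep by blast
    qed (use h s s2 in \<open>auto simp: field_simps\<close>)
    \<comment> \<open>As s \<ge> p, the larger root is at least p + 2h and the smaller at most
      2h.\<close>
    moreover have "(p + 4 * h + s) / 2 \<ge> \<Delta>" "(p + 4 * h - s) / 2 \<le> \<Delta>"
      using bds s h by auto
    ultimately show "signless_laplacian_energy V E = (p - 1) * (\<Delta> - 2 * h) + 2 * (h - 1) * (p + h - \<Delta>)
           + (p - \<Delta>) + sqrt ((p + 4 * h)\<^sup>2 - 16 * h\<^sup>2)"
      unfolding s_def[symmetric] using bds h pos by (simp add: avg abs_of_nonneg abs_of_nonpos field_simps) }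
qed


text \<open>Here k stands for (m - 1)/2. Clearing the denominator leaves x(x - 1)y^2 > (xy - 1)(x +
  1) with x = k and y = z; at (2, 2) this fails as 8 against 9.\<close>

lemma bipartite_hyper_iff:
  fixes k z :: nat
  assumes k: "k \<ge> 1" and z: "z \<ge> 1"
  defines "p \<equiv> real k * real z" and "q \<equiv> real z"
  shows "2 * q + (p - q) * (2 * p * q / (p + q)) > 2 * (p + q - 1)
           \<longleftrightarrow> \<not> (z = 1 \<or> k = 1 \<or> (k, z) = (2, 2))"
proof -
  define x y where "x = real k" and "y = real z"
  have x: "x \<ge> 1" and y: "y \<ge> 1" using k z by (auto simp: x_def y_def)
  have "(p - q) * (2 * p * q / (p + q)) = 2 * (x * (x - 1) * y * y / (x + 1))"
  proof -
    have "p + q = (x + 1) * y" by (simp add: p_def q_def x_def y_def algebra_simps)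
    moreover have "p = x * y" "q = y" by (auto simp: p_def q_def x_def y_def)
    ultimately show ?thesis using x y by (simp add: divide_simps) (simp add: algebra_simps)
  qed
  hence "2 * q + (p - q) * (2 * p * q / (p + q)) > 2 * (p + q - 1)
      \<longleftrightarrow> x * (x - 1) * y * y / (x + 1) > x * y - 1"
    unfolding p_def q_def x_def[symmetric] y_def[symmetric] by auto
  also have "\<dots> \<longleftrightarrow> x * (x - 1) * y * y > (x * y - 1) * (x + 1)"
    using x by (simp add: pos_less_divide_eq)
  also have "\<dots> \<longleftrightarrow> \<not> (z = 1 \<or> k = 1 \<or> (k, z) = (2, 2))"
  proof -
    consider "z = 1" | "k = 1" | "k = 2" "z = 2" | "k = 2" "z \<ge> 3" | "k \<ge> 3" "z \<ge> 2"
      using k z by linarith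
    thus ?thesis
    proof cases
      case 1
      hence "y = 1" by (simp add: y_def)
      thus ?thesis using 1 x by (simp add: algebra_simps)
    next
      case 2
      hence "x = 1" by (simp add: x_def)
      thus ?thesis using 2 y by simp
    next
      case 3
      thus ?thesis by (simp add: x_def y_def)
    next
      case 4
      hence "x = 2" "y \<ge> 3" by (auto simp: x_def y_def)
      moreover have "3 * y \<le> y * y" using \<open>y \<ge> 3\<close> by (intro mult_right_mono) auto
      hence "6 * y - 3 < 2 * (y * y)" using \<open>y \<ge> 3\<close> by linarith
      ultimately have "x * (x - 1) * y * y > (x * y - 1) * (x + 1)" by simp
      thus ?thesis using 4 by simp
    next
      case 5
      hence xy: "x \<ge> 3" "y \<ge> 2" by (auto simp: x_def y_def)
      \<comment> \<open>For x \<ge> 3 this yields x^2 y + xy \<le> 2x(x - 1)y, and y \<ge> 2 then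
        allows replacing 2y by y^2.\<close>
      have *: "x * y * 3 \<le> x * y * x" using xy by (intro mult_left_mono) auto
      have "(x * y - 1) * (x + 1) < x * y * x + x * y" using xy by (simp add: algebra_simps)
      also have "\<dots> \<le> 2 * (x * y * x) - 2 * (x * y)" using * by linarith
      also have "\<dots> = x * (x - 1) * (2 * y)" by (simp add: algebra_simps)
      also have "\<dots> \<le> x * (x - 1) * (y * y)"
        using xy by (intro mult_left_mono mult_right_mono) auto
      finally have "x * (x - 1) * y * y > (x * y - 1) * (x + 1)" by (simp add: mult.assoc)
      thus ?thesis using 5 by simp
    qed
  qed
  finally show ?thesis .
qed

text \<open>Substituting \<open>x = m - 3\<close> and \<open>y = z / 2\<close> makes every term of the excess nonnegative.\<close>

lemma tripartite_L_excess:
  fixes x y :: real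
  assumes x: "x \<ge> 1" and y: "y \<ge> 1" and p: "p = (x + 2) * y"
  defines "\<Delta> \<equiv> 2 * y * (2 * p + y) / (p + 2 * y)"
  shows "(p - 1) * (\<Delta> - 2 * y) + 2 * (y - 1) * (p + y - \<Delta>) + \<Delta> + 2 * (p + 2 * y - \<Delta>) - 2 * (p + 2 * y - 1)
    = ((y - 1) * ((4 * x\<^sup>2 + 12 * x + 8) * (y - 1) + 6 * x\<^sup>2 + 12 * x) + 2 * x\<^sup>2 + 2 * x) / (x + 4)"
    (is "?L = ?R / _")
proof -
  \<comment> \<open>A factor y cancels in \<Delta> because p + 2y = (x + 4)y, so multiplying by x +
    4 makes the excess polynomial.\<close>
  have D: "\<Delta> * (x + 4) = y * (4 * x + 10)"
  proof -
    have "p + 2 * y = (x + 4) * y" unfolding p by (simp add: algebra_simps)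
    hence "\<Delta> = 2 * (2 * p + y) / (x + 4)" unfolding \<Delta>_def using y by simp
    hence "\<Delta> * (x + 4) = 2 * (2 * p + y)" using x by simp
    thus ?thesis unfolding p by (simp add: algebra_simps)
  qed
  have "?L = \<Delta> * x * y + 2 * y * y - 2 * (x + 2) * y + 2"
    unfolding p by (simp add: algebra_simps)
  hence "?L * (x + 4) = (\<Delta> * x * y + 2 * y * y - 2 * (x + 2) * y + 2) * (x + 4)"
    by (simp only:)
  also have "\<dots> = (\<Delta> * (x + 4)) * x * y + (x + 4) * (2 * y * y - 2 * (x + 2) * y + 2)"
    by (simp add: algebra_simps)
  also have "\<dots> = ?R"
    unfolding D by (simp add: algebra_simps power2_eq_square)
  finally show ?thesis using x by (simp add: eq_divide_eq)
qed

lemma complete_bipartite_hyperenergetic: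
  fixes k z :: nat
  assumes cm: "complete_multipartite V E \<kappa> {0, 1 :: nat} (\<lambda>i. if i = 0 then real k * real z else real z)"
    and k: "k \<ge> 1" and z: "z \<ge> 1"
  shows "\<not> hyperenergetic V E"
    and "L_hyperenergetic V E \<longleftrightarrow> \<not> (z = 1 \<or> k = 1 \<or> (k, z) = (2, 2))"
    and "Q_hyperenergetic V E \<longleftrightarrow> \<not> (z = 1 \<or> k = 1 \<or> (k, z) = (2, 2))"
    and "k = 1 \<Longrightarrow> z = 1 \<Longrightarrow> borderenergetic V E \<and> L_borderenergetic V E \<and> Q_borderenergetic V E"
proof -
  define p q where "p = real k * real z" and "q = real z"
  have q1: "q \<ge> 1" and "real k \<ge> 1" using k z by (auto simp: q_def)
  hence pq: "p \<ge> q" unfolding p_def q_def by (simp add: mult_le_cancel_right1)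
  \<comment> \<open>Each of p and q is at most p + q - 1, since both are at least 1.\<close>
  hence "p * q \<le> (p + q - 1) * (p + q - 1)" using q1 by (intro mult_mono) auto
  hence "sqrt (p * q) \<le> p + q - 1" using pq q1 by (intro real_le_lsqrt) (auto simp: power2_eq_square)
  note le = this
  note en = complete_bipartite_energies[OF cm[folded p_def q_def] pq, folded p_def q_def]
  have q0: "q > 0" using q1 by simp
  show "\<not> hyperenergetic V E"
    unfolding hyperenergetic_def complete_energy_def en(1,2)[OF q0] using le by simp
  show "L_hyperenergetic V E \<longleftrightarrow> \<not> (z = 1 \<or> k = 1 \<or> (k, z) = (2, 2))"
    unfolding L_hyperenergetic_def complete_energy_def en(1,3)[OF q0]
    by (rule bipartite_hyper_iff[OF k z, folded p_def q_def])
  show "Q_hyperenergetic V E \<longleftrightarrow> \<not> (z = 1 \<or> k = 1 \<or> (k, z) = (2, 2))"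
    unfolding Q_hyperenergetic_def complete_energy_def en(1,4)[OF q0]
    by (rule bipartite_hyper_iff[OF k z, folded p_def q_def])
  assume "k = 1" "z = 1"
  hence "p = 1" "q = 1" by (auto simp: p_def q_def)
  thus "borderenergetic V E \<and> L_borderenergetic V E \<and> Q_borderenergetic V E"
    unfolding borderenergetic_def L_borderenergetic_def Q_borderenergetic_def complete_energy_def en[OF q0]
    by simp
qed

text \<open>The excess of LE is T/(x + 4) > 0, and SE - LE = s - (x + 6)y. Since s \<ge> (x + 4)y,
  it suffices for Q that T > 2y(x + 4), which holds everywhere except at x = y = 1.\<close>

lemma complete_tripartite_hyperenergetic:
  fixes m h :: nat
  assumes cm: "complete_multipartite V E \<kappa> {0, 1, 2 :: nat} (\<lambda>i. if i = 0 then (real m - 1) * real h else real h)"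
    and m: "m \<ge> 4" "even m" and h: "h \<ge> 1"
  shows "\<not> hyperenergetic V E" and "L_hyperenergetic V E"
    and "Q_hyperenergetic V E \<longleftrightarrow> \<not> (m = 4 \<and> h = 1)"
proof -
  define p y x where "p = (real m - 1) * real h" and "y = real h" and "x = real m - 3"
  have x: "x \<ge> 1" and y: "y \<ge> 1" using m h by (auto simp: x_def y_def)
  have p: "p = (x + 2) * y" unfolding p_def x_def y_def by simp
  have p3: "p \<ge> 3 * y" unfolding p using x y by (intro mult_right_mono) auto
  have y0: "y > 0" using y by simp
  define \<Delta> where "\<Delta> = 2 * y * (2 * p + y) / (p + 2 * y)"
  define s where "s = sqrt ((p + 4 * y)\<^sup>2 - 16 * y\<^sup>2)"
  note en = complete_tripartite_energies[OF cm[folded p_def y_def] p3 y0, folded \<Delta>_def s_def]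
  define B where "B = (4 * x\<^sup>2 + 12 * x + 8) * (y - 1) + 6 * x\<^sup>2 + 12 * x"
  define T where "T = (y - 1) * B + 2 * x\<^sup>2 + 2 * x"
  have "B \<ge> 0" unfolding B_def using x y by simp
  hence "T > 0" unfolding T_def using x y by (simp add: add_nonneg_pos)
  have L: "laplacian_energy V E - 2 * (p + 2 * y - 1) = T / (x + 4)"
    unfolding en T_def B_def \<Delta>_def by (rule tripartite_L_excess[OF x y p])
  have Q: "signless_laplacian_energy V E - laplacian_energy V E = s - (x + 6) * y"
    unfolding en p by (simp add: algebra_simps)
  \<comment> \<open>The aim is to bound the root by 2p + y: then the energy is at most 2p + 2y, and
    y \<ge> 1 puts this below 2(p + 2y - 1).\<close>
  have "y * y \<le> p * y" using p3 y by (intro mult_right_mono) auto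
  hence "8 * y * p \<le> 4 * p * p + 4 * p * y"
    using mult_right_mono[of y p p] p3 y by simp
  hence "y\<^sup>2 + 8 * y * p \<le> (2 * p + y)\<^sup>2"
    by (simp add: power2_eq_square algebra_simps)
  hence "sqrt (y\<^sup>2 + 8 * y * p) \<le> 2 * p + y" using p3 y by (intro real_le_lsqrt) auto
  thus "\<not> hyperenergetic V E"
    unfolding hyperenergetic_def complete_energy_def en using y by simp
  have "T / (x + 4) > 0" using \<open>T > 0\<close> x by simp
  thus "L_hyperenergetic V E"
    unfolding L_hyperenergetic_def complete_energy_def en(1) using L by linarith
  have Qh: "Q_hyperenergetic V E \<longleftrightarrow> T / (x + 4) + s - (x + 6) * y > 0"
    unfolding Q_hyperenergetic_def complete_energy_def en(1) using L Q by linarith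
  \<comment> \<open>Splitting off ((x + 4)y)^2 makes the lower bound on s visible.\<close>
  have "(p + 4 * y)\<^sup>2 - 16 * y\<^sup>2 = ((x + 4) * y)\<^sup>2 + (4 * x + 4) * y\<^sup>2"
    unfolding p by (simp add: power2_eq_square algebra_simps)
  hence s: "s = sqrt (((x + 4) * y)\<^sup>2 + (4 * x + 4) * y\<^sup>2)" unfolding s_def by simp
  have s_ge: "s \<ge> (x + 4) * y"
    unfolding s using x y by (intro real_le_rsqrt) simp
  have eq: "T - 2 * y * (x + 4) = (y - 1) * (B - 2 * x - 8) + 2 * x\<^sup>2 - 8"
    unfolding T_def by (simp add: algebra_simps)
  show "Q_hyperenergetic V E \<longleftrightarrow> \<not> (m = 4 \<and> h = 1)"
  proof (cases "m = 4 \<and> h = 1")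
    case True
    hence xy: "x = 1" "y = 1" by (auto simp: x_def y_def)
    \<comment> \<open>Here T = 4, so the quantity in \<open>Qh\<close> is at most 4/5 + 6 - 7 <
      0.\<close>
    have "s \<le> 6" unfolding s xy by (intro real_le_lsqrt) auto
    thus ?thesis using True unfolding Qh by (simp add: T_def B_def xy)
  next
    case False
    have "T - 2 * y * (x + 4) > 0"
    proof (cases "m = 4")
      case True
      hence "x = 1" "y \<ge> 2" using False h by (auto simp: x_def y_def)
      moreover have "1 * 32 \<le> (y - 1) * (24 * (y - 1) + 8)"
        using \<open>y \<ge> 2\<close> by (intro mult_mono) auto
      ultimately show ?thesis unfolding eq by (simp add: B_def algebra_simps)
    next
      case False
      \<comment> \<open>Then x \<ge> 3, so 2x^2 - 8 > 0 and the other term of \<open>eq\<close> is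
        nonnegative.\<close>
      hence "m \<ge> 6" using m by presburger
      hence x3: "x \<ge> 3" by (simp add: x_def)
      have "x * x \<ge> 3 * x" using x3 by (intro mult_right_mono) auto
      hence x2: "x\<^sup>2 \<ge> 9" unfolding power2_eq_square using x3 by linarith
      have "0 \<le> (4 * x\<^sup>2 + 12 * x + 8) * (y - 1)" using x y by simp
      hence "B - 2 * x - 8 \<ge> 0" unfolding B_def using x3 x2 by linarith
      hence "(y - 1) * (B - 2 * x - 8) \<ge> 0" using y by simp
      thus ?thesis unfolding eq using x2 by linarith
    qed
    hence "T / (x + 4) > 2 * y" using x by (simp add: pos_less_divide_eq)
    thus ?thesis using s_ge False unfolding Qh by (simp add: algebra_simps)
  qed
qed

section \<open>Groups with dihedral central quotient\<close>

text \<open>\<open>f\<close> is the projection to the central quotient followed by an isomorphism,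
  so that no cosets appear below. \<open>fst (f x)\<close> is the rotation exponent, and
  \<open>snd (f x)\<close> tells whether x lies over a reflection.\<close>

locale dihedral_central_quotient = group G for G :: "('a, 'b) monoid_scheme" (structure) +
  fixes m :: nat and f :: "'a \<Rightarrow> int \<times> bool"
  assumes fin: "finite (carrier G)" and m: "m \<ge> 3"
    and f_mult: "\<And>x y. x \<in> carrier G \<Longrightarrow> y \<in> carrier G \<Longrightarrow> f (x \<otimes> y) = f x \<otimes>\<^bsub>dihedral_group m\<^esub> f y"
    and f_image: "f ` carrier G = carrier (dihedral_group m)"
    and f_eq_iff: "\<And>x y. x \<in> carrier G \<Longrightarrow> y \<in> carrier G \<Longrightarrow> f x = f y \<longleftrightarrow> (\<exists>c\<in>group_center G. y = x \<otimes> c)"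
begin

abbreviation Z where "Z \<equiv> group_center G"

section \<open>Rotations, reflections and their commutation\<close>

lemma f_carrier: "x \<in> carrier G \<Longrightarrow> 0 \<le> fst (f x) \<and> fst (f x) < int m"
  using imageI[of x "carrier G" f, unfolded f_image] by (cases "f x") (simp add: dihedral_group_def)

lemma snd_f_mult: "x \<in> carrier G \<Longrightarrow> y \<in> carrier G \<Longrightarrow> snd (f (x \<otimes> y)) \<longleftrightarrow> snd (f x) \<noteq> snd (f y)"
  by (cases "f x"; cases "f y") (simp add: f_mult dihedral_group_def)

lemma fst_f_mult: "x \<in> carrier G \<Longrightarrow> y \<in> carrier G \<Longrightarrow>
    fst (f (x \<otimes> y)) = (fst (f x) + (if snd (f x) then - fst (f y) else fst (f y))) mod int m"
  by (cases "f x"; cases "f y") (simp add: f_mult dihedral_group_def)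

text \<open>From f(1) = f(1 * 1): the flag s satisfies s = (s \<noteq> s), and the exponent k
  satisfies k = 2k mod m with 0 \<le> k < m.\<close>

lemma f_one: "f \<one> = (0, False)"
proof -
  have s: "\<not> snd (f \<one>)" using snd_f_mult[of \<one> \<one>] by simp
  have "fst (f \<one>) = (fst (f \<one>) + fst (f \<one>)) mod int m" using fst_f_mult[of \<one> \<one>] s by simp
  hence "int m dvd fst (f \<one>)"
    by (metis add_diff_cancel_right' mod_eq_dvd_iff mod_mod_trivial)
  hence "fst (f \<one>) = 0" using f_carrier[of \<one>] zdvd_not_zless[of "fst (f \<one>)" "int m"] by fastforce
  with s show ?thesis by (simp add: prod_eq_iff)
qed

lemma center_iff: "x \<in> Z \<longleftrightarrow> x \<in> carrier G \<and> f x = (0, False)"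
proof
  assume x: "x \<in> Z"
  hence "x \<in> carrier G" by (simp add: group_center_def)
  moreover from this have "x = \<one> \<otimes> x" by simp
  ultimately show "x \<in> carrier G \<and> f x = (0, False)" using x f_eq_iff[of \<one> x] by (metis f_one one_closed)
next
  assume x: "x \<in> carrier G \<and> f x = (0, False)"
  hence "\<exists>c\<in>Z. x = \<one> \<otimes> c" using f_eq_iff[of \<one> x] by (simp add: f_one)
  thus "x \<in> Z" by (auto simp: group_center_def)
qed

lemma center_carrier: "x \<in> Z \<Longrightarrow> x \<in> carrier G"
  by (simp add: group_center_def)

lemma center_comm: "x \<in> Z \<Longrightarrow> y \<in> carrier G \<Longrightarrow> x \<otimes> y = y \<otimes> x"
  by (simp add: group_center_def)

lemma snd_f_inv: "x \<in> carrier G \<Longrightarrow> snd (f (inv x)) \<longleftrightarrow> snd (f x)"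
  using snd_f_mult[of x "inv x"] by (simp add: f_one)

definition a where "a = (SOME x. x \<in> carrier G \<and> f x = (1, False))"

lemma a: "a \<in> carrier G" "f a = (1, False)"
proof -
  have "(1, False) \<in> f ` carrier G" unfolding f_image using m by (simp add: dihedral_group_def)
  hence "\<exists>x. x \<in> carrier G \<and> f x = (1, False)" by force
  from someI_ex[OF this, folded a_def] show "a \<in> carrier G" "f a = (1, False)" by auto
qed

lemma f_a_pow: "f (a [^] k) = (int k mod int m, False)" for k :: nat
proof (induction k)
  case 0
  show ?case by (simp add: f_one)
next
  case (Suc k)
  show ?case using Suc a fst_f_mult[of "a [^] k" a] snd_f_mult[of "a [^] k" a]
    by (simp add: prod_eq_iff mod_simps add_ac)
qed

lemma f_a_pow_inv: "f (inv (a [^] k)) = (- int k mod int m, False)" for k :: nat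
proof -
  let ?x = "a [^] k"
  have x: "?x \<in> carrier G" using a by simp
  have "fst (f (?x \<otimes> inv ?x)) = (int k + fst (f (inv ?x))) mod int m"
    using fst_f_mult[of ?x "inv ?x"] x by (simp add: f_a_pow mod_simps)
  hence "(int k + fst (f (inv ?x))) mod int m = 0" using x by (simp add: f_one)
  hence "fst (f (inv ?x)) mod int m = - int k mod int m"
    by (metis add.commute add.inverse_inverse mod_eq_dvd_iff diff_minus_eq_add mod_0_imp_dvd)
  moreover have "fst (f (inv ?x)) mod int m = fst (f (inv ?x))"
    using f_carrier[of "inv ?x"] x by simp
  ultimately show ?thesis using snd_f_inv[OF x] by (simp add: prod_eq_iff f_a_pow)
qed

lemma rotation_eq:
  assumes x: "x \<in> carrier G" "\<not> snd (f x)"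
  obtains k c where "k < m" "c \<in> Z" "x = a [^] (k :: nat) \<otimes> c"
proof -
  define k where "k = nat (fst (f x))"
  have k: "k < m" "int k = fst (f x)" using f_carrier[OF x(1)] by (auto simp: k_def)
  have "f (a [^] k) = f x" using x k by (simp add: f_a_pow prod_eq_iff)
  then obtain c where "c \<in> Z" "x = a [^] k \<otimes> c" using f_eq_iff[of "a [^] k" x] x a by auto
  with k that show ?thesis by blast
qed

text \<open>Every rotation is a power of the single element \<open>a\<close> times a central
  element.\<close>

lemma rotations_commute:
  assumes x: "x \<in> carrier G" "\<not> snd (f x)" and y: "y \<in> carrier G" "\<not> snd (f y)"
  shows "x \<otimes> y = y \<otimes> x"
proof -
  obtain k c where k: "c \<in> Z" "x = a [^] (k :: nat) \<otimes> c" using rotation_eq[OF x] by metis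
  obtain l d where l: "d \<in> Z" "y = a [^] (l :: nat) \<otimes> d" using rotation_eq[OF y] by metis
  have C: "c \<in> carrier G" "d \<in> carrier G" "a [^] k \<in> carrier G" "a [^] l \<in> carrier G"
    using k l a center_carrier by auto
  have "x \<otimes> y = a [^] k \<otimes> (c \<otimes> a [^] l) \<otimes> d" using C by (simp add: k l m_assoc)
  also have "\<dots> = (a [^] k \<otimes> a [^] l) \<otimes> (c \<otimes> d)"
    unfolding center_comm[OF k(1) C(4)] using C by (simp add: m_assoc)
  also have "a [^] k \<otimes> a [^] l = a [^] l \<otimes> a [^] k"
    using a by (simp add: nat_pow_mult add.commute)
  also have "c \<otimes> d = d \<otimes> c" by (rule center_comm[OF k(1) C(2)])
  also have "a [^] l \<otimes> a [^] k \<otimes> (d \<otimes> c) = a [^] l \<otimes> (a [^] k \<otimes> d) \<otimes> c"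
    using C by (simp add: m_assoc)
  also have "a [^] k \<otimes> d = d \<otimes> a [^] k" by (rule center_comm[OF l(1) C(3), symmetric])
  also have "a [^] l \<otimes> (d \<otimes> a [^] k) \<otimes> c = y \<otimes> x" using C by (simp add: k l m_assoc)
  finally show ?thesis .
qed

text \<open>Any other reflection is y times a rotation, so if x commuted with y it would commute
  with all of G and be central.\<close>

lemma rotation_reflection_not_commute:
  assumes x: "x \<in> carrier G" "\<not> snd (f x)" "x \<notin> Z" and y: "y \<in> carrier G" "snd (f y)"
  shows "x \<otimes> y \<noteq> y \<otimes> x"
proof
  assume xy: "x \<otimes> y = y \<otimes> x"
  have "x \<otimes> w = w \<otimes> x" if w: "w \<in> carrier G" for w
  proof (cases "snd (f w)")
    case False
    thus ?thesis using rotations_commute x w by simp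
  next
    case True
    let ?v = "inv y \<otimes> w"
    have v: "?v \<in> carrier G" "w = y \<otimes> ?v" using y w by (auto simp: m_assoc[symmetric])
    have "\<not> snd (f ?v)" using y w True by (simp add: snd_f_mult snd_f_inv)
    hence xv: "x \<otimes> ?v = ?v \<otimes> x" using rotations_commute x v by blast
    have "x \<otimes> (y \<otimes> ?v) = (y \<otimes> x) \<otimes> ?v" using x(1) y(1) v(1) xy by (simp add: m_assoc[symmetric])
    also have "\<dots> = y \<otimes> (?v \<otimes> x)" using x(1) y(1) v(1) xv by (simp add: m_assoc)
    also have "\<dots> = (y \<otimes> ?v) \<otimes> x" using x(1) y(1) v(1) by (simp add: m_assoc)
    finally show ?thesis using v by simp
  qed
  hence "x \<in> Z" using x by (simp add: group_center_def)
  with x show False by simp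
qed

text \<open>Write y = xv with v a rotation. If x and y commute, then v commutes with the reflection
  x and is therefore central.\<close>

lemma reflections_commute_iff:
  assumes x: "x \<in> carrier G" "snd (f x)" and y: "y \<in> carrier G" "snd (f y)"
  shows "x \<otimes> y = y \<otimes> x \<longleftrightarrow> f x = f y"
proof
  assume "f x = f y"
  then obtain c where c: "c \<in> Z" "y = x \<otimes> c" using f_eq_iff x y by blast
  hence "c \<in> carrier G" "c \<otimes> x = x \<otimes> c" using center_carrier center_comm x by auto
  thus "x \<otimes> y = y \<otimes> x" using c x by (simp add: m_assoc)
next
  assume xy: "x \<otimes> y = y \<otimes> x"
  let ?v = "inv x \<otimes> y"
  have v: "?v \<in> carrier G" "y = x \<otimes> ?v" using x y by (auto simp: m_assoc[symmetric])
  have "\<not> snd (f ?v)" using x y by (simp add: snd_f_mult snd_f_inv)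
  moreover have "?v \<otimes> x = x \<otimes> ?v"
  proof -
    have "?v \<otimes> x = inv x \<otimes> (x \<otimes> y)" using x(1) y(1) xy by (simp add: m_assoc)
    also have "\<dots> = y" using x(1) y(1) by (simp add: m_assoc[symmetric])
    finally show ?thesis using v by simp
  qed
  ultimately have "?v \<in> Z" using rotation_reflection_not_commute[of ?v x] x v by blast
  thus "f x = f y" using f_eq_iff x y v by blast
qed

section \<open>Conjugacy classes of noncentral elements\<close>

lemma conj_class_self: "x \<in> carrier G \<Longrightarrow> x \<in> conj_class G x"
  unfolding conj_class_def by (auto intro!: exI[of _ \<one>])

lemma conj_class_carrier: "x \<in> carrier G \<Longrightarrow> conj_class G x \<subseteq> carrier G"
  unfolding conj_class_def by auto

lemma conj_class_eq:
  assumes x: "x \<in> carrier G" and y: "y \<in> conj_class G x"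
  shows "conj_class G y = conj_class G x"
proof -
  have sub: "conj_class G y \<subseteq> conj_class G x" if x: "x \<in> carrier G" and y: "y \<in> conj_class G x" for x y
  proof
    fix w assume "w \<in> conj_class G y"
    then obtain g h where "g \<in> carrier G" "h \<in> carrier G" "w = g \<otimes> (h \<otimes> x \<otimes> inv h) \<otimes> inv g"
      using y by (auto simp: conj_class_def)
    hence "g \<otimes> h \<in> carrier G" "w = (g \<otimes> h) \<otimes> x \<otimes> inv (g \<otimes> h)"
      using x by (auto simp: m_assoc inv_mult_group)
    thus "w \<in> conj_class G x" unfolding conj_class_def by blast
  qed
  obtain g where g: "g \<in> carrier G" "y = g \<otimes> x \<otimes> inv g" using y by (auto simp: conj_class_def)
  hence yc: "y \<in> carrier G" using x by simp
  have "x = inv g \<otimes> y \<otimes> inv (inv g)"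
    using g x by (simp add: m_assoc) (simp flip: m_assoc)
  hence "x \<in> conj_class G y" unfolding conj_class_def using g by blast
  thus ?thesis using sub[OF x y] sub[OF yc] by blast
qed

text \<open>Rotations centralise x, so a conjugate of x depends only on whether the conjugating
  element is a rotation or a reflection.\<close>

lemma conj_class_rotation:
  assumes x: "x \<in> carrier G" "\<not> snd (f x)" "x \<notin> Z"
  shows "card (conj_class G x) = 2" and "y \<in> conj_class G x \<Longrightarrow> \<not> snd (f y) \<and> y \<notin> Z"
proof -
  have "(0, True) \<in> f ` carrier G" unfolding f_image using m by (simp add: dihedral_group_def)
  then obtain b where b: "b \<in> carrier G" "snd (f b)" by (metis imageE snd_conv)
  let ?y = "b \<otimes> x \<otimes> inv b"
  have rot: "g \<otimes> x \<otimes> inv g = x" if "g \<in> carrier G" "\<not> snd (f g)" for g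
    using rotations_commute[OF that x(1,2)] that x(1) by (simp add: m_assoc)
  have "conj_class G x = {x, ?y}"
  proof
    show "{x, ?y} \<subseteq> conj_class G x"
      using b x conj_class_self by (auto simp: conj_class_def)
    show "conj_class G x \<subseteq> {x, ?y}"
    proof
      fix w assume "w \<in> conj_class G x"
      then obtain g where g: "g \<in> carrier G" "w = g \<otimes> x \<otimes> inv g" by (auto simp: conj_class_def)
      show "w \<in> {x, ?y}"
      proof (cases "snd (f g)")
        case False
        thus ?thesis using rot g by simp
      next
        case True
        let ?v = "inv b \<otimes> g"
        have v: "?v \<in> carrier G" "g = b \<otimes> ?v" using b g by (auto simp: m_assoc[symmetric])
        have "\<not> snd (f ?v)" using b g True by (simp add: snd_f_mult snd_f_inv)
        hence "?v \<otimes> x \<otimes> inv ?v = x" using rot v by blast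
        moreover have "w = b \<otimes> (?v \<otimes> x \<otimes> inv ?v) \<otimes> inv b"
        proof -
          have "w = (b \<otimes> ?v) \<otimes> x \<otimes> inv (b \<otimes> ?v)" using g v by simp
          also have "\<dots> = b \<otimes> (?v \<otimes> x \<otimes> inv ?v) \<otimes> inv b"
            using b v(1) x(1) by (simp add: inv_mult_group[of b ?v] m_assoc del: inv_mult_group)
          finally show ?thesis .
        qed
        ultimately show ?thesis by simp
      qed
    qed
  qed
  moreover have "x \<noteq> ?y"
  proof
    assume "x = ?y"
    hence "x \<otimes> b = ?y \<otimes> b" by simp
    also have "\<dots> = b \<otimes> x" using b x by (simp add: m_assoc)
    finally show False using rotation_reflection_not_commute x b by blast
  qed
  ultimately show "card (conj_class G x) = 2" by simp
  assume "y \<in> conj_class G x"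
  then obtain g where g: "g \<in> carrier G" "y = g \<otimes> x \<otimes> inv g" by (auto simp: conj_class_def)
  have "y \<notin> Z"
  proof
    assume "y \<in> Z"
    hence "y \<otimes> g = g \<otimes> y" using center_comm g by blast
    moreover have "y \<otimes> g = g \<otimes> x" using g x by (simp add: m_assoc)
    ultimately have "g \<otimes> x = g \<otimes> y" by simp
    hence "x = y" using g x by simp
    with \<open>y \<in> Z\<close> x show False by simp
  qed
  thus "\<not> snd (f y) \<and> y \<notin> Z" using g x by (simp add: snd_f_mult snd_f_inv)
qed

text \<open>Since x centralises itself, conjugating by a reflection g equals conjugating by the
  rotation gx, and central factors drop out, leaving powers of \<open>a\<close>. Two of them with
  equal conjugates differ by a power of \<open>a\<close> that commutes with x, hence is central,
  which exponents below m exclude.\<close>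

lemma conj_class_reflection:
  assumes x: "x \<in> carrier G" "snd (f x)"
  shows "conj_class G x = (\<lambda>k :: nat. a [^] k \<otimes> x \<otimes> inv (a [^] k)) ` {..<m}"
    and "card (conj_class G x) = m"
proof -
  let ?c = "\<lambda>k :: nat. a [^] k \<otimes> x \<otimes> inv (a [^] k)"
  show eq: "conj_class G x = ?c ` {..<m}"
  proof
    show "?c ` {..<m} \<subseteq> conj_class G x"
      using a by (auto simp: conj_class_def)
    show "conj_class G x \<subseteq> ?c ` {..<m}"
    proof
      fix w assume "w \<in> conj_class G x"
      then obtain g where g: "g \<in> carrier G" "w = g \<otimes> x \<otimes> inv g" by (auto simp: conj_class_def)
      have "\<exists>g'\<in>carrier G. \<not> snd (f g') \<and> w = g' \<otimes> x \<otimes> inv g'"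
      proof (cases "snd (f g)")
        case True
        have "(g \<otimes> x) \<otimes> x \<otimes> inv (g \<otimes> x) = g \<otimes> x \<otimes> inv g"
          using g(1) x(1) by (simp add: inv_mult_group m_assoc) (simp add: m_assoc[symmetric])
        moreover have "g \<otimes> x \<in> carrier G" "\<not> snd (f (g \<otimes> x))"
          using g x True by (auto simp: snd_f_mult)
        ultimately show ?thesis using g by metis
      qed (use g in blast)
      then obtain g' where g': "g' \<in> carrier G" "\<not> snd (f g')" "w = g' \<otimes> x \<otimes> inv g'" by blast
      obtain k c where k: "k < m" "c \<in> Z" "g' = a [^] (k :: nat) \<otimes> c" using rotation_eq[OF g'(1,2)] by blast
      have C: "c \<in> carrier G" "a [^] k \<in> carrier G" using k a center_carrier by auto
      have "w = a [^] k \<otimes> (c \<otimes> x) \<otimes> inv c \<otimes> inv (a [^] k)"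
        using g' k C x by (simp add: inv_mult_group m_assoc)
      also have "c \<otimes> x = x \<otimes> c" by (rule center_comm[OF k(2) x(1)])
      also have "a [^] k \<otimes> (x \<otimes> c) \<otimes> inv c \<otimes> inv (a [^] k) = ?c k"
        using C x by (simp add: m_assoc)
      finally show "w \<in> ?c ` {..<m}" using k by blast
    qed
  qed
  have "inj_on ?c {..<m}"
  proof (rule linorder_inj_onI)
    fix k l assume kl: "k < l" "k \<in> {..<m}" "l \<in> {..<m}"
    let ?d = "a [^] (l - k)"
    have d: "?d \<in> carrier G" "a [^] k \<in> carrier G" "a [^] l = a [^] k \<otimes> ?d"
      using a kl by (auto simp: nat_pow_mult)
    show "?c k \<noteq> ?c l"
    proof
      assume "?c k = ?c l"
      also have "?c l = a [^] k \<otimes> (?d \<otimes> x \<otimes> inv ?d) \<otimes> inv (a [^] k)"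
        unfolding d(3) using d(1,2) x by (simp add: inv_mult_group m_assoc)
      finally have "x = ?d \<otimes> x \<otimes> inv ?d" using d(1,2) x by simp
      hence "x \<otimes> ?d = (?d \<otimes> x \<otimes> inv ?d) \<otimes> ?d" by simp
      hence "?d \<otimes> x = x \<otimes> ?d" using d x by (simp add: m_assoc)
      hence "?d \<in> Z" using rotation_reflection_not_commute[of ?d x] d x by (auto simp: f_a_pow)
      hence "int (l - k) mod int m = 0" by (simp add: center_iff f_a_pow)
      thus False using kl by (simp flip: of_nat_mod)
    qed
  qed auto
  thus "card (conj_class G x) = m" unfolding eq by (simp add: card_image)
qed

text \<open>The factor 2 separates the cases: it preserves parity when m is even and is invertible
  modulo m when m is odd.\<close>

lemma f_conj_reflection:
  fixes k :: nat
  assumes x: "x \<in> carrier G" "snd (f x)"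
  shows "f (a [^] k \<otimes> x \<otimes> inv (a [^] k)) = ((fst (f x) + 2 * int k) mod int m, True)"
proof -
  have "a [^] k \<in> carrier G" using a by simp
  thus ?thesis using x
    by (simp add: prod_eq_iff fst_f_mult snd_f_mult f_a_pow f_a_pow_inv mod_simps algebra_simps)
qed

text \<open>Each fibre of \<open>f\<close> is a coset of the centre.\<close>

lemma card_preimage:
  assumes T: "T \<subseteq> carrier (dihedral_group m)"
  shows "card {x \<in> carrier G. f x \<in> T} = card Z * card T"
proof -
  have finT: "finite T" using finite_subset[OF T] finite_imageI[OF fin, of f, unfolded f_image] by blast
  have fibre: "card {x \<in> carrier G. f x = d} = card Z" if d: "d \<in> T" for d
  proof -
    have "d \<in> f ` carrier G" using d T unfolding f_image by blast
    then obtain y where y: "y \<in> carrier G" "d = f y" by blast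
    have "x \<in> carrier G \<and> f x = d \<longleftrightarrow> x \<in> (\<lambda>c. y \<otimes> c) ` Z" for x
      using y(1) f_eq_iff[OF y(1), of x] center_carrier unfolding y(2) image_iff
      by (metis m_closed)
    hence "{x \<in> carrier G. f x = d} = (\<lambda>c. y \<otimes> c) ` Z" by blast
    moreover have "inj_on (\<lambda>c. y \<otimes> c) Z" using y center_carrier by (auto simp: inj_on_def)
    ultimately show ?thesis by (simp add: card_image)
  qed
  have "card {x \<in> carrier G. f x \<in> T} = (\<Sum>d\<in>T. card {x \<in> {x \<in> carrier G. f x \<in> T}. f x = d})"
    unfolding card_eq_sum by (rule sum.group[symmetric]) (use fin finT in auto)
  also have "\<dots> = (\<Sum>d\<in>T. card {x \<in> carrier G. f x = d})"
    by (intro sum.cong refl arg_cong[of _ _ card]) auto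
  finally show ?thesis by (simp add: fibre)
qed

text \<open>Reflections \<open>(k, True)\<close> and \<open>(l, True)\<close> of the dihedral group are conjugate iff \<open>m\<close> is odd or
  \<open>k\<close> and \<open>l\<close> have the same parity; this determines the parts of the graph.\<close>

definition part :: "'a \<Rightarrow> nat" where
  "part x = (if snd (f x) then 1 + (if even m then nat (fst (f x) mod 2) else 0) else 0)"

lemma part_conj_class:
  assumes x: "x \<in> carrier G" "x \<notin> Z" and y: "y \<in> conj_class G x"
  shows "part y = part x"
proof (cases "snd (f x)")
  case False
  thus ?thesis using conj_class_rotation(2)[OF x(1) False x(2) y] by (simp add: part_def)
next
  case True
  then obtain k where "y = a [^] (k :: nat) \<otimes> x \<otimes> inv (a [^] k)"
    using y conj_class_reflection(1)[OF x(1) True] by blast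
  hence fy: "f y = ((fst (f x) + 2 * int k) mod int m, True)"
    using f_conj_reflection[OF x(1) True] by simp
  have "(fst (f x) + 2 * int k) mod int m mod 2 = fst (f x) mod 2" if "even m"
  proof -
    have "(2 :: int) dvd int m" using that by simp
    thus ?thesis by (simp add: mod_mod_cancel)
  qed
  thus ?thesis using True by (simp add: part_def fy)
qed

text \<open>By the shift formula one has to solve 2j = d modulo m for the difference d of the
  exponents. The resulting conjugate commutes with y, so classes in one part are not
  adjacent.\<close>

lemma equal_part_imp_conj:
  assumes x: "x \<in> carrier G" "snd (f x)" and y: "y \<in> carrier G" "snd (f y)"
    and eq: "part x = part y"
  shows "\<exists>w \<in> conj_class G x. f w = f y"
proof -
  let ?d = "fst (f y) - fst (f x)"
  have "\<exists>j :: int. 2 * j mod int m = ?d mod int m"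
  proof (cases "even m")
    case True
    have "nat (fst (f x) mod 2) = nat (fst (f y) mod 2)"
      using eq x y True by (simp add: part_def)
    hence "fst (f x) mod 2 = fst (f y) mod 2" by (simp add: eq_nat_nat_iff)
    hence "2 dvd ?d" by (simp add: mod_eq_dvd_iff dvd_diff_commute)
    then obtain j where "?d = 2 * j" by (elim dvdE)
    thus ?thesis by auto
  next
    case False
    then obtain t where t: "int m = 2 * t + 1" by (metis even_of_nat oddE)
    \<comment> \<open>t + 1 is the inverse of 2 modulo m = 2t + 1.\<close>
    have "2 * (?d * (t + 1)) = ?d + ?d * int m" by (simp add: t algebra_simps)
    hence "2 * (?d * (t + 1)) mod int m = ?d mod int m" by simp
    thus ?thesis by blast
  qed
  then obtain j :: int where j: "2 * j mod int m = ?d mod int m" by blast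
  define k where "k = nat (j mod int m)"
  have k: "int k = j mod int m" using m by (simp add: k_def)
  let ?w = "a [^] k \<otimes> x \<otimes> inv (a [^] k)"
  have "(fst (f x) + 2 * int k) mod int m = (fst (f x) + 2 * j mod int m) mod int m"
    unfolding k by (metis mod_add_right_eq mod_mult_right_eq)
  also have "\<dots> = fst (f y) mod int m" unfolding j by (simp add: mod_simps)
  also have "\<dots> = fst (f y)" using f_carrier[OF y(1)] by simp
  finally have "f ?w = f y" using f_conj_reflection[OF x] y(2) by (simp add: prod_eq_iff)
  moreover have "?w \<in> conj_class G x" unfolding conj_class_def using a by auto
  ultimately show ?thesis by blast
qed

text \<open>The choice of representative is harmless, because \<open>part\<close> is constant on
  noncentral classes.\<close>

definition class_part :: "'a set \<Rightarrow> nat" where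
  "class_part A = part (SOME x. x \<in> A)"

lemma class_part:
  assumes x: "x \<in> carrier G" "x \<notin> Z"
  shows "class_part (conj_class G x) = part x"
proof -
  have "(SOME y. y \<in> conj_class G x) \<in> conj_class G x"
    using someI_ex[of "\<lambda>y. y \<in> conj_class G x"] conj_class_self[OF x(1)] by blast
  thus ?thesis unfolding class_part_def using part_conj_class[OF x] by blast
qed

lemma conj_class_noncentral:
  assumes x: "x \<in> carrier G" "x \<notin> Z" and y: "y \<in> conj_class G x"
  shows "y \<in> carrier G \<and> y \<notin> Z"
proof -
  have yc: "y \<in> carrier G" using conj_class_carrier[OF x(1)] y by blast
  show ?thesis
  proof (cases "snd (f x)")
    case False
    thus ?thesis using conj_class_rotation(2)[OF x(1) False x(2) y] yc by blast
  next
    case True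
    hence "snd (f y)" using part_conj_class[OF x y] by (simp add: part_def split: if_splits)
    thus ?thesis using yc center_iff[of y] by auto
  qed
qed

text \<open>Within a part a commuting pair exists: two rotations, or a reflection and a conjugate of
  the other with the same image. Across parts every pair is a rotation with a reflection, or two
  reflections with different images.\<close>

lemma nccc_adj_iff:
  assumes A: "A \<in> nccc_vertices G" and B: "B \<in> nccc_vertices G"
  shows "nccc_adj G A B \<longleftrightarrow> class_part A \<noteq> class_part B"
proof -
  obtain x where x: "x \<in> carrier G" "x \<notin> Z" "A = conj_class G x"
    using A by (auto simp: nccc_vertices_def)
  obtain y where y: "y \<in> carrier G" "y \<notin> Z" "B = conj_class G y"
    using B by (auto simp: nccc_vertices_def)
  have parts: "class_part A = part x" "class_part B = part y"
    using x y class_part by auto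
  have nc: "u \<in> carrier G \<and> u \<notin> Z \<and> v \<in> carrier G \<and> v \<notin> Z" if "u \<in> A" "v \<in> B" for u v
    using conj_class_noncentral x y that by blast
  have xX: "x \<in> A" and yY: "y \<in> B" using x y conj_class_self by auto
  show ?thesis
  proof (cases "part x = part y")
    case True
    have "\<exists>u\<in>A. \<exists>v\<in>B. u \<otimes> v = v \<otimes> u"
    proof (cases "snd (f x)")
      case False
      hence "\<not> snd (f y)" using True by (simp add: part_def split: if_splits)
      with False show ?thesis using rotations_commute x y xX yY by blast
    next
      case T: True
      hence sy: "snd (f y)" using True by (simp add: part_def split: if_splits)
      obtain w where w: "w \<in> A" "f w = f y"
        using equal_part_imp_conj[OF x(1) T y(1) sy True] x by blast
      hence "w \<otimes> y = y \<otimes> w"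
        using reflections_commute_iff[of w y] nc[OF w(1) yY] sy by simp
      thus ?thesis using w yY by blast
    qed
    thus ?thesis using True parts by (auto simp: nccc_adj_def)
  next
    case False
    have "u \<otimes> v \<noteq> v \<otimes> u" if u: "u \<in> A" and v: "v \<in> B" for u v
    proof -
      have c: "u \<in> carrier G" "u \<notin> Z" "v \<in> carrier G" "v \<notin> Z" using nc[OF u v] by auto
      have "part u \<noteq> part v" using False part_conj_class x y u v by metis
      hence "f u \<noteq> f v" unfolding part_def by metis
      consider "snd (f u)" "snd (f v)" | "\<not> snd (f u)" "snd (f v)" | "snd (f u)" "\<not> snd (f v)"
        using \<open>part u \<noteq> part v\<close> by (auto simp: part_def split: if_splits)
      thus ?thesis
        using reflections_commute_iff[of u v] rotation_reflection_not_commute[of u v]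
          rotation_reflection_not_commute[of v u] c \<open>f u \<noteq> f v\<close>
        by cases auto
    qed
    thus ?thesis using False parts by (auto simp: nccc_adj_def)
  qed
qed

text \<open>The classes of part i partition the preimage of \<open>T\<close> into blocks of size n,
  and that preimage has \<open>card Z * card T\<close> elements.\<close>

lemma card_classes:
  assumes card: "\<And>x. x \<in> carrier G \<Longrightarrow> x \<notin> Z \<Longrightarrow> part x = i \<Longrightarrow> card (conj_class G x) = n"
    and T: "T \<subseteq> carrier (dihedral_group m)"
      "\<And>x. x \<in> carrier G \<Longrightarrow> x \<notin> Z \<and> part x = i \<longleftrightarrow> f x \<in> T"
  shows "n * card {A \<in> nccc_vertices G. class_part A = i} = card Z * card T"
proof -
  let ?C = "{A \<in> nccc_vertices G. class_part A = i}"
  have C: "?C = conj_class G ` {x \<in> carrier G. f x \<in> T}"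
  proof -
    have "A \<in> ?C \<longleftrightarrow> (\<exists>x\<in>carrier G. x \<notin> Z \<and> part x = i \<and> A = conj_class G x)" for A
      by (auto simp: nccc_vertices_def class_part)
    thus ?thesis using T(2) by blast
  qed
  have un: "\<Union>?C = {x \<in> carrier G. f x \<in> T}"
  proof
    show "\<Union>?C \<subseteq> {x \<in> carrier G. f x \<in> T}"
    proof
      fix y assume "y \<in> \<Union>?C"
      then obtain x where "x \<in> carrier G" "f x \<in> T" "y \<in> conj_class G x" unfolding C by blast
      thus "y \<in> {x \<in> carrier G. f x \<in> T}"
        using T(2)[of x] T(2)[of y] conj_class_noncentral[of x y] part_conj_class[of x y] by auto
    qed
    show "{x \<in> carrier G. f x \<in> T} \<subseteq> \<Union>?C"
      unfolding C using conj_class_self by blast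
  qed
  have "n * card ?C = card (\<Union>?C)"
  proof (rule card_partition)
    show "finite ?C" unfolding C using fin by simp
    show "finite (\<Union>?C)" unfolding un using fin by simp
    show "card A = n" if "A \<in> ?C" for A
      using that card T(2) unfolding C by blast
    show "A \<inter> B = {}" if "A \<in> ?C" "B \<in> ?C" "A \<noteq> B" for A B
    proof (rule ccontr)
      assume "A \<inter> B \<noteq> {}"
      then obtain w where "w \<in> A" "w \<in> B" by blast
      moreover obtain x y where "x \<in> carrier G" "A = conj_class G x" "y \<in> carrier G" "B = conj_class G y"
        using \<open>A \<in> ?C\<close> \<open>B \<in> ?C\<close> unfolding C by blast
      ultimately have "A = B" using conj_class_eq by metis
      with that show False by simp
    qed
  qed
  also have "\<dots> = card Z * card T" unfolding un by (rule card_preimage[OF T(1)])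
  finally show ?thesis .
qed

lemma card_rotation_classes:
  "2 * card {A \<in> nccc_vertices G. class_part A = 0} = card Z * (m - 1)"
proof -
  have "card ({1..<int m} \<times> {False}) = m - 1" by (simp add: card_cartesian_product)
  moreover have "2 * card {A \<in> nccc_vertices G. class_part A = 0} = card Z * card ({1..<int m} \<times> {False})"
  proof (rule card_classes)
    fix x assume x: "x \<in> carrier G"
    show "x \<notin> Z \<and> part x = 0 \<longleftrightarrow> f x \<in> {1..<int m} \<times> {False}"
      using f_carrier[OF x] x center_iff[of x]
      by (cases "f x") (auto simp: part_def split: if_splits)
  qed (auto simp: dihedral_group_def part_def split: if_splits intro: conj_class_rotation(1))
  ultimately show ?thesis by simp
qed

lemma card_reflection_classes_odd:
  assumes "odd m"
  shows "card {A \<in> nccc_vertices G. class_part A = 1} = card Z"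
proof -
  have "card ({0..<int m} \<times> {True}) = m" by (simp add: card_cartesian_product)
  moreover have "m * card {A \<in> nccc_vertices G. class_part A = 1} = card Z * card ({0..<int m} \<times> {True})"
  proof (rule card_classes)
    fix x assume x: "x \<in> carrier G"
    show "x \<notin> Z \<and> part x = 1 \<longleftrightarrow> f x \<in> {0..<int m} \<times> {True}"
      using f_carrier[OF x] x center_iff[of x] assms
      by (cases "f x") (auto simp: part_def split: if_splits)
  qed (auto simp: dihedral_group_def part_def split: if_splits intro: conj_class_reflection(2))
  ultimately show ?thesis using m by simp
qed

lemma card_reflection_classes_even:
  assumes m2: "even m" and i: "i \<in> {1, 2}"
  shows "2 * card {A \<in> nccc_vertices G. class_part A = i} = card Z"
proof -
  \<comment> \<open>Parts 1 and 2 hold the reflections of even and odd exponent, so the parity is i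
    - 1; m/2 exponents have it.\<close>
  let ?r = "int i - 1"
  let ?T = "(\<lambda>t. (2 * t + ?r, True)) ` {0..<int m div 2}"
  have "card ?T = m div 2" by (subst card_image) (auto simp: inj_on_def nat_div_distrib)
  moreover have "m * card {A \<in> nccc_vertices G. class_part A = i} = card Z * card ?T"
  proof (rule card_classes)
    fix x assume x: "x \<in> carrier G"
    obtain k s where fx: "f x = (k, s)" by fastforce
    have k: "0 \<le> k" "k < int m" using f_carrier[OF x] fx by auto
    have "(0 \<le> k \<and> k < int m \<and> k mod 2 = ?r) \<longleftrightarrow> k \<in> (\<lambda>t. 2 * t + ?r) ` {0..<int m div 2}"
    proof
      assume "0 \<le> k \<and> k < int m \<and> k mod 2 = ?r"
      hence "k = 2 * (k div 2) + ?r" "k div 2 \<in> {0..<int m div 2}"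
        using m2 mult_div_mod_eq[of 2 k] by (linarith, auto)
      thus "k \<in> (\<lambda>t. 2 * t + ?r) ` {0..<int m div 2}" by blast
    next
      assume "k \<in> (\<lambda>t. 2 * t + ?r) ` {0..<int m div 2}"
      thus "0 \<le> k \<and> k < int m \<and> k mod 2 = ?r" using i m2 by auto
    qed
    moreover have "part x = i \<longleftrightarrow> s \<and> k mod 2 = ?r" using i m2 by (auto simp: part_def fx)
    moreover have "s \<Longrightarrow> x \<notin> Z" using center_iff fx by auto
    ultimately show "x \<notin> Z \<and> part x = i \<longleftrightarrow> f x \<in> ?T" unfolding fx using k by auto
  next
    show "?T \<subseteq> carrier (dihedral_group m)" using i m2 by (auto simp: dihedral_group_def)
    show "card (conj_class G x) = m" if "x \<in> carrier G" "part x = i" for x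
      using that i by (intro conj_class_reflection(2)) (auto simp: part_def split: if_splits)
  qed
  ultimately have "m * (2 * card {A \<in> nccc_vertices G. class_part A = i}) = m * card Z"
    using m2 by auto
  thus ?thesis using m by simp
qed

section \<open>The NCCC-graph as a complete multipartite graph\<close>

lemma class_part_image:
  assumes "card {A \<in> nccc_vertices G. class_part A = i} > 0"
  shows "i \<in> class_part ` nccc_vertices G"
proof -
  have "{A \<in> nccc_vertices G. class_part A = i} \<noteq> {}" using assms by (metis card.empty less_irrefl)
  thus ?thesis by blast
qed

lemma class_part_image_subset:
  assumes "\<And>x. part x \<in> S"
  shows "class_part ` nccc_vertices G \<subseteq> S"
proof
  fix i assume "i \<in> class_part ` nccc_vertices G"
  then obtain x where "x \<in> carrier G" "x \<notin> Z" "i = class_part (conj_class G x)"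
    by (auto simp: nccc_vertices_def)
  thus "i \<in> S" using assms[of x] by (simp add: class_part)
qed

lemma card_center_pos: "card Z > 0"
proof -
  have "\<one> \<in> Z" by (simp add: center_iff f_one)
  moreover have "finite Z" using fin center_carrier by (auto intro: finite_subset)
  ultimately show ?thesis by (auto simp: card_gt_0_iff)
qed

lemma finite_vertices: "finite (nccc_vertices G)"
  unfolding nccc_vertices_def using fin by simp

lemma nccc_graph_odd:
  assumes "odd m"
  shows "complete_multipartite (nccc_vertices G) (nccc_adj G) class_part {0, 1}
           (\<lambda>i. if i = 0 then real ((m - 1) div 2) * real (card Z) else real (card Z))"
proof
  let ?n = "\<lambda>i. card {A \<in> nccc_vertices G. class_part A = i}"
  have n0: "2 * ?n 0 = card Z * (m - 1)" by (rule card_rotation_classes)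
  have n1: "?n 1 = card Z" by (rule card_reflection_classes_odd[OF assms])
  obtain t where t: "m = 2 * t + 1" using assms by (elim oddE)
  have "?n 0 = t * card Z" using n0 by (simp add: t)
  note n = this n1
  hence "?n 0 > 0" "?n 1 > 0" using card_center_pos m t by auto
  hence "0 \<in> class_part ` nccc_vertices G" "1 \<in> class_part ` nccc_vertices G"
    by (auto intro!: class_part_image)
  moreover have "class_part ` nccc_vertices G \<subseteq> {0, 1}"
    by (rule class_part_image_subset) (simp add: part_def assms)
  ultimately show "class_part ` nccc_vertices G = {0, 1}" by blast
  show "(if k = 0 then real ((m - 1) div 2) * real (card Z) else real (card Z)) = real (?n k)"
    if "k \<in> {0, 1}" for k
    using that n by (auto simp: t)
qed (use finite_vertices nccc_adj_iff in auto)

text \<open>Taking h to be a number of classes avoids halving \<open>card Z\<close>; that the centre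
  has even order comes out of the count.\<close>

lemma nccc_graph_even:
  assumes "even m" and h: "h = card {A \<in> nccc_vertices G. class_part A = 1}"
  shows "complete_multipartite (nccc_vertices G) (nccc_adj G) class_part {0, 1, 2}
           (\<lambda>i. if i = 0 then (real m - 1) * real h else real h)"
    and "card Z = 2 * h"
proof -
  let ?n = "\<lambda>i. card {A \<in> nccc_vertices G. class_part A = i}"
  have n0: "2 * ?n 0 = card Z * (m - 1)" by (rule card_rotation_classes)
  have n1: "2 * ?n 1 = card Z" "2 * ?n 2 = card Z" using card_reflection_classes_even[OF assms(1)] by auto
  thus Z: "card Z = 2 * h" using h by simp
  hence n: "?n 0 = (m - 1) * h" "?n 1 = h" "?n 2 = h" using n0 n1 by auto
  have "h > 0" using card_center_pos Z by simp
  hence "?n 0 > 0" "?n 1 > 0" "?n 2 > 0" using n m by auto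
  hence "0 \<in> class_part ` nccc_vertices G" "1 \<in> class_part ` nccc_vertices G" "2 \<in> class_part ` nccc_vertices G"
    by (auto intro!: class_part_image)
  moreover have "class_part ` nccc_vertices G \<subseteq> {0, 1, 2}"
  proof (rule class_part_image_subset)
    show "part x \<in> {0, 1, 2}" for x
      using pos_mod_bound[of 2 "fst (f x)"] pos_mod_sign[of 2 "fst (f x)"] by (auto simp: part_def)
  qed
  ultimately have parts: "class_part ` nccc_vertices G = {0, 1, 2}" by blast
  show "complete_multipartite (nccc_vertices G) (nccc_adj G) class_part {0, 1, 2}
           (\<lambda>i. if i = 0 then (real m - 1) * real h else real h)"
  proof
    show "(if k = 0 then (real m - 1) * real h else real h) = real (?n k)" if "k \<in> {0, 1, 2}" for k
      using that n m by (auto simp: of_nat_diff)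
  qed (use finite_vertices nccc_adj_iff parts in auto)
qed

end

section \<open>From the quotient isomorphism to the map \<open>f\<close>\<close>

lemma (in group) center_subgroup: "subgroup (group_center G) G"
proof
  show "group_center G \<subseteq> carrier G" by (auto simp: group_center_def)
  show "\<one> \<in> group_center G" by (simp add: group_center_def)
  fix x assume x: "x \<in> group_center G"
  hence xc: "x \<in> carrier G" "\<And>w. w \<in> carrier G \<Longrightarrow> x \<otimes> w = w \<otimes> x"
    by (auto simp: group_center_def)
  have "inv x \<otimes> w = w \<otimes> inv x" if w: "w \<in> carrier G" for w
  proof -
    have "inv x \<otimes> w = inv x \<otimes> (w \<otimes> x) \<otimes> inv x" using xc(1) w by (simp add: m_assoc)
    also have "\<dots> = inv x \<otimes> (x \<otimes> w) \<otimes> inv x" using xc w by simp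
    finally show ?thesis using xc(1) w by (simp flip: m_assoc)
  qed
  moreover have "inv x \<in> carrier G" using xc(1) by simp
  ultimately show "inv x \<in> group_center G" unfolding group_center_def by blast
  fix y assume y: "y \<in> group_center G"
  hence yc: "y \<in> carrier G" "\<And>w. w \<in> carrier G \<Longrightarrow> y \<otimes> w = w \<otimes> y"
    by (auto simp: group_center_def)
  have "x \<otimes> y \<otimes> w = w \<otimes> (x \<otimes> y)" if w: "w \<in> carrier G" for w
  proof -
    have "x \<otimes> y \<otimes> w = x \<otimes> (w \<otimes> y)" using xc(1) yc w by (simp add: m_assoc)
    also have "\<dots> = (w \<otimes> x) \<otimes> y" using xc yc(1) w by (simp flip: m_assoc)
    finally show ?thesis using xc(1) yc(1) w by (simp add: m_assoc)
  qed
  moreover have "x \<otimes> y \<in> carrier G" using xc(1) yc(1) by simp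
  ultimately show "x \<otimes> y \<in> group_center G" unfolding group_center_def by blast
qed

lemma (in group) center_normal: "group_center G \<lhd> G"
  unfolding normal_inv_iff
proof (intro conjI ballI)
  fix x h assume x: "x \<in> carrier G" and h: "h \<in> group_center G"
  hence hc: "h \<in> carrier G" "x \<otimes> h = h \<otimes> x" by (auto simp: group_center_def)
  hence "x \<otimes> h \<otimes> inv x = h" using x by (simp add: m_assoc)
  thus "x \<otimes> h \<otimes> inv x \<in> group_center G" using h by simp
qed (rule center_subgroup)

lemma (in group) dihedral_central_quotient_exists:
  assumes "finite (carrier G)" "m \<ge> 3" "G Mod (group_center G) \<cong> dihedral_group m"
  shows "\<exists>f. dihedral_central_quotient G m f"
proof -
  interpret N: normal "group_center G" G by (rule center_normal)
  obtain h where h: "h \<in> iso (G Mod (group_center G)) (dihedral_group m)"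
    using assms(3) by (auto simp: is_iso_def)
  define f where "f x = h (group_center G #> x)" for x
  have hhom: "h \<in> hom (G Mod (group_center G)) (dihedral_group m)"
    and hbij: "bij_betw h (carrier (G Mod (group_center G))) (carrier (dihedral_group m))"
    using h by (auto simp: iso_def)
  have coset: "group_center G #> x \<in> carrier (G Mod (group_center G))" if "x \<in> carrier G" for x
    using that by (auto simp: FactGroup_def RCOSETS_def)
  have "dihedral_central_quotient G m f"
  proof
    fix x y assume xy: "x \<in> carrier G" "y \<in> carrier G"
    show "f (x \<otimes> y) = f x \<otimes>\<^bsub>dihedral_group m\<^esub> f y"
      unfolding f_def using hom_mult[OF hhom coset[OF xy(1)] coset[OF xy(2)]] N.rcos_sum[OF xy]
      by (simp add: FactGroup_def)
    have "f x = f y \<longleftrightarrow> group_center G #> x = group_center G #> y"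
      unfolding f_def using hbij coset xy by (auto simp: bij_betw_def dest: inj_onD)
    also have "\<dots> \<longleftrightarrow> y \<in> group_center G #> x"
      using repr_independence[of y "group_center G" x] center_subgroup xy rcos_self[of y "group_center G"] by auto
    \<comment> \<open>The coset has its central factor on the left, and centrality moves it to the
      right.\<close>
    also have "\<dots> \<longleftrightarrow> (\<exists>c\<in>group_center G. y = x \<otimes> c)"
    proof -
      have "c \<otimes> x = x \<otimes> c" if "c \<in> group_center G" for c
        using that xy(1) unfolding group_center_def by blast
      thus ?thesis unfolding r_coset_def by simp
    qed
    finally show "f x = f y \<longleftrightarrow> (\<exists>c\<in>group_center G. y = x \<otimes> c)" .
  next
    have "carrier (G Mod (group_center G)) = (\<lambda>x. group_center G #> x) ` carrier G"
      by (auto simp: FactGroup_def RCOSETS_def)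
    hence "f ` carrier G = h ` carrier (G Mod (group_center G))"
      by (simp add: f_def image_image)
    thus "f ` carrier G = carrier (dihedral_group m)"
      using bij_betw_imp_surj_on[OF hbij] by simp
  qed (use assms in auto)
  thus ?thesis by blast
qed

theorem theorem4p3:
  fixes G :: "('a, 'b) monoid_scheme" and m z :: nat
  assumes "group G" and "finite (carrier G)"
    and "m \<ge> 3"
    and "G Mod (group_center G) \<cong> dihedral_group m"
    and "z = card (group_center G)"
  shows "(m = 3 \<and> z = 1 \<longrightarrow> borderenergetic (nccc_vertices G) (nccc_adj G))
       \<and> \<not> hyperenergetic (nccc_vertices G) (nccc_adj G)
       \<and> (m = 3 \<and> z = 1 \<longrightarrow> L_borderenergetic (nccc_vertices G) (nccc_adj G))
       \<and> (L_hyperenergetic (nccc_vertices G) (nccc_adj G)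
            \<longleftrightarrow> \<not> (z = 1 \<or> m = 3 \<or> (m, z) = (5, 2)))
       \<and> (m = 3 \<and> z = 1 \<longrightarrow> Q_borderenergetic (nccc_vertices G) (nccc_adj G))
       \<and> (Q_hyperenergetic (nccc_vertices G) (nccc_adj G)
            \<longleftrightarrow> \<not> (z = 1 \<or> m = 3 \<or> (m, z) = (5, 2) \<or> (m, z) = (4, 2)))"
proof -
  obtain f where "dihedral_central_quotient G m f"
    using group.dihedral_central_quotient_exists[OF assms(1-4)] by blast
  then interpret dihedral_central_quotient G m f .
  show ?thesis
  proof (cases "even m")
    case True
    define h where "h = card {A \<in> nccc_vertices G. class_part A = 1}"
    note graph = nccc_graph_even[OF True h_def]
    have "h \<ge> 1" "m \<ge> 4" using graph(2) card_center_pos True m by (auto elim!: evenE)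
    note en = complete_tripartite_hyperenergetic[OF graph(1) this(2) True this(1)]
    \<comment> \<open>With m and z both even, (4, 2) is the only listed exception that can
      occur.\<close>
    have "m \<noteq> 3" "m \<noteq> 5" using True by auto
    moreover have "z \<noteq> 1" "z = 2 \<longleftrightarrow> h = 1" using graph(2) assms(5) by presburger+
    ultimately show ?thesis using en by simp
  next
    case False
    then obtain k where k: "m = 2 * k + 1" by (elim oddE)
    hence "(m - 1) div 2 = k" by simp
    note graph = nccc_graph_odd[OF False, unfolded this, folded assms(5)]
    have "k \<ge> 1" "z \<ge> 1" using k m card_center_pos assms(5) by auto
    note en = complete_bipartite_hyperenergetic[OF graph this]
    \<comment> \<open>Translates the exceptions k = 1 and (2, 2) into m = 3 and (5, 2).\<close>
    have "m = 3 \<longleftrightarrow> k = 1" "m = 5 \<longleftrightarrow> k = 2" "m \<noteq> 4" using k by presburger+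
    thus ?thesis using en by auto
  qed
qed

end
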